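(* Let $s$ be a fixed quadratic section and let $\varphi,\varphi'\in\mathcal{E}(q)$. There exists a $\mathbb{Z}_2[\mathbb{Z}_2]$-isomorphism $$\Psi\colon H_1(E_\varphi,(E_\varphi)_0;\mathbb{Z}_2)\to H_1(E_{\varphi'},(E_{\varphi'})_0;\mathbb{Z}_2)$$ which is a quotient if and only if $\varphi$ and $\varphi'$ are $s$-related.
   Context: Setting. $g\ge1$, $F_g$ is the closed oriented surface of genus $g$, and $S^1\hookrightarrow P\xrightarrow{p}F_g$ is a principal $S^1$-bundle with even Chern class $q=2c$. $\pi_1(F_g)=\langle x_1,\dots,x_{2g}\mid \prod_{j=1}^g[x_{2j-1},x_{2j}]\rangle$ is the standard presentation. $u_0\in\pi_1(P)$ is the image of a generator of $\pi_1(S^1)$ (the fiber), and $u_i\in\pi_1(P)$, $1\le i\le 2g$, are chosen with $p_\sharp(u_i)=x_i$, so that $\pi_1(P)=\langle u_0,u_1,\dots,u_{2g}\mid R_0,R_1,\dots,R_{2g}\rangle$ with $R_i=[u_i,u_0]$ ($1\le i\le 2g$) and $R_0=\prod_{\ell=1}^g[u_{2\ell-1},u_{2\ell}]\,u_0^{2c}$. Special coverings. $\mathcal{E}(q)$ is the set of homomorphisms $\varphi\colon\pi_1(P)\to\mathbb{Z}_2$ with $\varphi(u_0)=1$ (the nontrivial element of additive $\mathbb{Z}_2$); these are the monodromies of the special $2$-fold coverings $E_\varphi\to P$; $(E_\varphi)_0$ is the two-point fiber over the base point of $P$. Let $h_P\colon\pi_1(P)\to H_1(P;\mathbb{Z}_2)$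 and $h_{F_g}\colon\pi_1(F_g)\to H_1(F_g;\mathbb{Z}_2)$ be the mod $2$ Hurewicz maps; $\varphi=\tilde\varphi\circ h_P$ with $\tilde\varphi\colon H_1(P;\mathbb{Z}_2)\to\mathbb{Z}_2$ linear. Quadratic section and $s$-relation. Put $\sigma_i=h_{F_g}(x_i)$ (a symplectic basis of $H_1(F_g;\mathbb{Z}_2)$ for the mod $2$ intersection product "$\cdot$") and $\nu_i=h_P(u_i)$, $0\le i\le 2g$ (a basis of $H_1(P;\mathbb{Z}_2)$). Given $r_1,\dots,r_{2g}\in\mathbb{Z}_2$, the quadratic section $s$ is the unique map $s\colon H_1(F_g;\mathbb{Z}_2)\to H_1(P;\mathbb{Z}_2)$ with $s(\sigma_i)=\nu_i+r_i\nu_0$ for $1\le i\le 2g$ and $s(a+b)=s(a)+s(b)+(a\cdot b)\nu_0$. For a symplectic automorphism $f$ of $(H_1(F_g;\mathbb{Z}_2),\cdot)$, $f_s$ is the linear automorphism of $H_1(P;\mathbb{Z}_2)$ with $f_s(s(\sigma_i))=s(f(\sigma_i))$ for $1\le i\le 2g$ and $f_s(\nu_0)=\nu_0$. $\varphi,\varphi'$ are $s$-related if $\tilde\varphi=\tilde\varphi'\circ f_s$ for some symplectic $f$. If $A=(a_{ij})$ is the matrix of $f$ in the basis $(\sigma_i)$ ($f(\sigma_j)=\sum_i a_{ij}\sigma_i$), the matrix of $f_s$ in $(\nu_1,\dots,\nu_{2g},\nu_0)$ is $J(A)=\begin{pmatrix}A&0\\ W&1\end{pmatrix}$, $W=(w_1,\dots,w_{2g})$,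 $w_j=\sum_{i=1}^{2g}a_{ij}r_i+\sum_{i=1}^g a_{2i,j}a_{2i-1,j}+r_j$. The module $H_\varphi\otimes\mathbb{Z}_2$. Let $\mathbb{Z}_2[\mathbb{Z}_2]=\mathbb{Z}_2[t]/(1-t^2)$; $M_2\otimes\mathbb{Z}_2$ is the free $\mathbb{Z}_2[\mathbb{Z}_2]$-module on $R_1,\dots,R_{2g},R_0$ and $M_1\otimes\mathbb{Z}_2$ the free one on $u_1,\dots,u_{2g},u_0$. The map $d_\varphi\colon M_2\otimes\mathbb{Z}_2\to M_1\otimes\mathbb{Z}_2$ (reduced mod 2) is $R_i\mapsto\sum_j\varphi(\partial R_i/\partial u_j)u_j$ (Fox derivatives; $\varphi$ extended to group rings with target written multiplicatively as $\{1,t\}$, $\varphi(u_0)=t$). Put $H_\varphi\otimes\mathbb{Z}_2=(M_1\otimes\mathbb{Z}_2)/\mathrm{Im}\,d_\varphi$. It is identified with $H_1(E_\varphi,(E_\varphi)_0;\mathbb{Z}_2)$ via the $\mathbb{Z}_2[\mathbb{Z}_2]$-isomorphism sending the class of $u_i$ to the relative homology class of the lift, starting at the chosen base point, of a loop representing $u_i$. With $n_i=\varphi(u_i)\in\{0,1\}$ and $v_i=u_i+n_iu_0$ ($1\le i\le 2g$), $H_\varphi\otimes\mathbb{Z}_2=\bigoplus_{i=1}^{2g}\mathbb{Z}_2\bar v_i\oplus\Lambda\bar u_0$ with $t$ acting trivially on $\bar v_i$, and $\Lambda=\mathbb{Z}_2[t]/(1-t^2,\,c(1+t))$, i.e. $\Lambda=\mathbb{Z}_2$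 if $c$ is odd and $\Lambda=\mathbb{Z}_2[\mathbb{Z}_2]$ if $c$ is even. Write $\bar v'_i$ for the corresponding elements for $\varphi'$ ($v_i'=u_i+\varphi'(u_i)u_0$). The product. $p_\varphi\colon H_\varphi\otimes\mathbb{Z}_2\to H_1(F_g;\mathbb{Z}_2)$ is $\sum_i d_i\bar v_i+y(t)\bar u_0\mapsto\sum_i d_i\sigma_i$, and $x\ast y:=p_\varphi(x)\cdot p_\varphi(y)\in\mathbb{Z}_2$. A $\mathbb{Z}_2[\mathbb{Z}_2]$-isomorphism $\Psi\colon H_\varphi\otimes\mathbb{Z}_2\to H_{\varphi'}\otimes\mathbb{Z}_2$ respecting the product ($\Psi(x)\ast\Psi(y)=x\ast y$) determines a symplectic automorphism $f$ of $H_1(F_g;\mathbb{Z}_2)$ with $f\circ p_\varphi=p_{\varphi'}\circ\Psi$. Quotient. For symplectic $f$ with matrix $A$, $\Psi_f\colon H_\varphi\otimes\mathbb{Z}_2\to H_{\varphi'}\otimes\mathbb{Z}_2$ is the isomorphism with matrix $\begin{pmatrix}A&0\\0&1\end{pmatrix}$ with respect to $(\bar v_1,\dots,\bar v_{2g},\bar u_0)$ and $(\bar v'_1,\dots,\bar v'_{2g},\bar u_0)$, and $\psi_f$ is the automorphism of $M_1\otimes\mathbb{Z}_2$ with matrix $J(A)$ in the basis $(u_1,\dots,u_{2g},u_0)$. An isomorphism $\Psi$ respecting the product $\ast$, with associated symplectic $f$, is called a quotient if $\Psi=\Psi_f$ and $\Psi$ is the quotient isomorphism of $\psi_f$, i.e.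 $\psi_f(\mathrm{Im}\,d_\varphi)=\mathrm{Im}\,d_{\varphi'}$ and $\Psi$ is the map induced by $\psi_f$ on the quotients. *)

theory Defs
  imports
    "HOL-Algebra.Generated_Groups"
    "HOL-Algebra.FiniteProduct"
    "HOL-Library.Poly_Mapping"
    "HOL-Library.Function_Algebras"
    "HOL-Library.Set_Algebras"
    "HOL-Library.Z2"
begin

section \<open>Words and group presentations\<close>

text \<open>The letter \<open>(i, True)\<close> is the \<open>i\<close>-th generator, \<open>(i, False)\<close> its inverse.
  A word stands for the element of the free group that it represents.\<close>

type_synonym word = "(nat \<times> bool) list"

fun word_val :: "('a, 'm) monoid_scheme \<Rightarrow> (nat \<Rightarrow> 'a) \<Rightarrow> word \<Rightarrow> 'a" where
  "word_val G u [] = \<one>\<^bsub>G\<^esub>"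
| "word_val G u ((i, b) # w) = (if b then u i else inv\<^bsub>G\<^esub> (u i)) \<otimes>\<^bsub>G\<^esub> word_val G u w"

text \<open>Equality of words in the group presented by the relators \<open>R\<close>: the congruence generated
  by free cancellation and by the relators.\<close>

inductive pres_eq :: "word set \<Rightarrow> word \<Rightarrow> word \<Rightarrow> bool" for R where
  refl: "pres_eq R w w"
| sym: "pres_eq R v w \<Longrightarrow> pres_eq R w v"
| trans: "pres_eq R v w \<Longrightarrow> pres_eq R w z \<Longrightarrow> pres_eq R v z"
| cong: "pres_eq R v v' \<Longrightarrow> pres_eq R w w' \<Longrightarrow> pres_eq R (v @ w) (v' @ w')"
| cancel: "pres_eq R [(i, b), (i, \<not> b)] []"
| relator: "w \<in> R \<Longrightarrow> pres_eq R w []"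

definition presented_by ::
  "('a, 'm) monoid_scheme \<Rightarrow> nat set \<Rightarrow> (nat \<Rightarrow> 'a) \<Rightarrow> word set \<Rightarrow> bool" where
  "presented_by G I u R \<longleftrightarrow>
     group G \<and> u ` I \<subseteq> carrier G \<and>
     carrier G = word_val G u ` lists (I \<times> UNIV) \<and>
     (\<forall>v \<in> lists (I \<times> UNIV). \<forall>w \<in> lists (I \<times> UNIV).
        word_val G u v = word_val G u w \<longleftrightarrow> pres_eq R v w)"

definition commutator_word :: "nat \<Rightarrow> nat \<Rightarrow> word" where
  "commutator_word i j = [(i, True), (j, True), (i, False), (j, False)]"

definition power_word :: "nat \<Rightarrow> int \<Rightarrow> word" where
  "power_word i k = replicate (nat \<bar>k\<bar>) (i, 0 \<le> k)"

definition surface_relator :: "nat \<Rightarrow> word" where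
  "surface_relator g = concat (map (\<lambda>l. commutator_word (2 * l - 1) (2 * l)) [1..<g + 1])"

definition bundle_relator :: "nat \<Rightarrow> int \<Rightarrow> nat \<Rightarrow> word" where
  "bundle_relator g c i =
     (if i = 0 then surface_relator g @ power_word 0 (2 * c) else commutator_word i 0)"


section \<open>Fox derivatives\<close>

text \<open>An integral group ring element of the free group is written as a formal integral
  combination of words; it is not reduced modulo free cancellation, which is invisible after the
  group ring homomorphism induced by a homomorphism is applied.\<close>

definition letter_mult :: "nat \<times> bool \<Rightarrow> (word \<Rightarrow>\<^sub>0 int) \<Rightarrow> (word \<Rightarrow>\<^sub>0 int)" where
  "letter_mult a = frag_extend (\<lambda>w. frag_of (a # w))"

fun fox :: "nat \<Rightarrow> word \<Rightarrow> (word \<Rightarrow>\<^sub>0 int)" where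
  "fox j [] = 0"
| "fox j ((i, b) # w) =
     (if i = j then (if b then frag_of [] else - frag_of [(i, False)]) else 0)
     + letter_mult (i, b) (fox j w)"


section \<open>Mod 2 homology of a group\<close>

text \<open>First homology with coefficients in the field of two elements is the abelianized
  fundamental group modulo squares, written multiplicatively as a quotient group.\<close>

definition mod2_kernel :: "('a, 'm) monoid_scheme \<Rightarrow> 'a set" where
  "mod2_kernel G = generate G (derived G (carrier G) \<union> {a \<otimes>\<^bsub>G\<^esub> a | a. a \<in> carrier G})"

abbreviation H1 :: "('a, 'm) monoid_scheme \<Rightarrow> 'a set monoid" where
  "H1 G \<equiv> G Mod mod2_kernel G"

definition hurewicz :: "('a, 'm) monoid_scheme \<Rightarrow> 'a \<Rightarrow> 'a set" where
  "hurewicz G a = mod2_kernel G #>\<^bsub>G\<^esub> a"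

definition bit_group :: "bit monoid" where
  "bit_group = \<lparr>carrier = UNIV, monoid.mult = (+), one = 0\<rparr>"

definition bit_scale :: "('a, 'm) monoid_scheme \<Rightarrow> bit \<Rightarrow> 'a \<Rightarrow> 'a" where
  "bit_scale V b a = (if b = 1 then a else \<one>\<^bsub>V\<^esub>)"

text \<open>The linear form on mod 2 homology through which a homomorphism to \<open>bit_group\<close> factors.\<close>

definition induced_form :: "('a \<Rightarrow> bit) \<Rightarrow> 'a set \<Rightarrow> bit" where
  "induced_form \<phi> C = the_elem (\<phi> ` C)"


section \<open>The group ring of the group of order two\<close>

text \<open>Multiplication of \<^typ>\<open>bit \<Rightarrow>\<^sub>0 bit\<close> is convolution over the additive group
  \<^typ>\<open>bit\<close>; the basis element at \<open>1\<close> is \<open>t\<close>, the one at \<open>0\<close> is the unit.\<close>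

type_synonym gring = "bit \<Rightarrow>\<^sub>0 bit"

definition scalar :: "bit \<Rightarrow> gring" where
  "scalar b = Poly_Mapping.single 0 b"

text \<open>The homomorphism of integral group rings induced by \<open>\<phi>\<close>, reduced mod 2.\<close>

definition ring_ext ::
  "('a, 'm) monoid_scheme \<Rightarrow> (nat \<Rightarrow> 'a) \<Rightarrow> ('a \<Rightarrow> bit) \<Rightarrow> (word \<Rightarrow>\<^sub>0 int) \<Rightarrow> gring" where
  "ring_ext G u \<phi> z =
     Poly_Mapping.map of_int (frag_extend (\<lambda>w. frag_of (\<phi> (word_val G u w))) z)"


section \<open>Circle bundles over a surface and quadratic sections\<close>

text \<open>\<open>piF\<close> and \<open>piP\<close> are the fundamental groups of the surface of genus \<open>g\<close> and of the total
  space of the circle bundle with Chern class \<open>2 c\<close>; \<open>p\<close> is induced by the bundle projection,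
  \<open>u 0\<close> is the class of the fiber.  \<open>ip\<close> is the mod 2 intersection product, the bilinear form
  for which the classes of the standard generators form the standard symplectic basis.
  The map \<open>s\<close> is the quadratic section with parameters \<open>r\<close>.\<close>

locale quadratic_section =
  fixes g :: nat and c :: int
    and piF :: "('f, 'm) monoid_scheme" and x :: "nat \<Rightarrow> 'f"
    and piP :: "('p, 'n) monoid_scheme" and u :: "nat \<Rightarrow> 'p"
    and p :: "'p \<Rightarrow> 'f"
    and ip :: "'f set \<Rightarrow> 'f set \<Rightarrow> bit"
    and r :: "nat \<Rightarrow> bit"
    and s :: "'f set \<Rightarrow> 'p set"
  assumes genus: "1 \<le> g"
    and piF: "presented_by piF {1..2 * g} x {surface_relator g}"
    and piP: "presented_by piP {0..2 * g} u (bundle_relator g c ` {0..2 * g})"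
    and p_hom: "p \<in> hom piP piF"
    and p_fiber: "p (u 0) = \<one>\<^bsub>piF\<^esub>"
    and p_gen: "\<And>i. i \<in> {1..2 * g} \<Longrightarrow> p (u i) = x i"
    and ip_left: "\<And>a b d. \<lbrakk>a \<in> carrier (H1 piF); b \<in> carrier (H1 piF); d \<in> carrier (H1 piF)\<rbrakk>
          \<Longrightarrow> ip (a \<otimes>\<^bsub>H1 piF\<^esub> b) d = ip a d + ip b d"
    and ip_right: "\<And>a b d. \<lbrakk>a \<in> carrier (H1 piF); b \<in> carrier (H1 piF); d \<in> carrier (H1 piF)\<rbrakk>
          \<Longrightarrow> ip d (a \<otimes>\<^bsub>H1 piF\<^esub> b) = ip d a + ip d b"
    and ip_basis: "\<And>i j. \<lbrakk>i \<in> {1..2 * g}; j \<in> {1..2 * g}\<rbrakk>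
          \<Longrightarrow> ip (hurewicz piF (x i)) (hurewicz piF (x j))
            = (if \<exists>l \<in> {1..g}. {i, j} = {2 * l - 1, 2 * l} then 1 else 0)"
    and s_closed: "\<And>a. a \<in> carrier (H1 piF) \<Longrightarrow> s a \<in> carrier (H1 piP)"
    and s_basis: "\<And>i. i \<in> {1..2 * g} \<Longrightarrow> s (hurewicz piF (x i))
          = hurewicz piP (u i) \<otimes>\<^bsub>H1 piP\<^esub> bit_scale (H1 piP) (r i) (hurewicz piP (u 0))"
    and s_quadratic: "\<And>a b. \<lbrakk>a \<in> carrier (H1 piF); b \<in> carrier (H1 piF)\<rbrakk>
          \<Longrightarrow> s (a \<otimes>\<^bsub>H1 piF\<^esub> b)
            = s a \<otimes>\<^bsub>H1 piP\<^esub> s b \<otimes>\<^bsub>H1 piP\<^esub> bit_scale (H1 piP) (ip a b) (hurewicz piP (u 0))"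
begin

definition \<sigma> :: "nat \<Rightarrow> 'f set" where "\<sigma> i = hurewicz piF (x i)"

definition \<nu> :: "nat \<Rightarrow> 'p set" where "\<nu> i = hurewicz piP (u i)"

definition special_monodromies :: "('p \<Rightarrow> bit) set" where
  "special_monodromies = {\<phi> \<in> hom piP bit_group. \<phi> (u 0) = 1}"

definition symplectic :: "('f set \<Rightarrow> 'f set) \<Rightarrow> bool" where
  "symplectic f \<longleftrightarrow> f \<in> iso (H1 piF) (H1 piF) \<and>
     (\<forall>a \<in> carrier (H1 piF). \<forall>b \<in> carrier (H1 piF). ip (f a) (f b) = ip a b)"

definition comb :: "(nat \<Rightarrow> bit) \<Rightarrow> 'f set" where
  "comb d = (\<Otimes>\<^bsub>H1 piF\<^esub>i \<in> {1..2 * g}. bit_scale (H1 piF) (d i) (\<sigma> i))"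

definition has_matrix :: "('f set \<Rightarrow> 'f set) \<Rightarrow> (nat \<Rightarrow> nat \<Rightarrow> bit) \<Rightarrow> bool" where
  "has_matrix f A \<longleftrightarrow> (\<forall>j \<in> {1..2 * g}. f (\<sigma> j) = comb (\<lambda>i. A i j))"


subsection \<open>The \<open>s\<close>-relation\<close>

text \<open>\<open>is_lift f F\<close> determines \<open>F\<close> on the carrier: \<open>F\<close> is the automorphism \<open>f\<^sub>s\<close>.\<close>

definition is_lift :: "('f set \<Rightarrow> 'f set) \<Rightarrow> ('p set \<Rightarrow> 'p set) \<Rightarrow> bool" where
  "is_lift f F \<longleftrightarrow> F \<in> iso (H1 piP) (H1 piP) \<and>
     (\<forall>i \<in> {1..2 * g}. F (s (\<sigma> i)) = s (f (\<sigma> i))) \<and> F (\<nu> 0) = \<nu> 0"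

definition s_related :: "('p \<Rightarrow> bit) \<Rightarrow> ('p \<Rightarrow> bit) \<Rightarrow> bool" where
  "s_related \<phi> \<phi>' \<longleftrightarrow>
     (\<exists>f F. symplectic f \<and> is_lift f F \<and>
        (\<forall>z \<in> carrier (H1 piP). induced_form \<phi> z = induced_form \<phi>' (F z)))"


subsection \<open>The relative homology module of a special covering\<close>

text \<open>The free modules on \<open>u\<^sub>0, \<dots>, u\<^bsub>2g\<^esub>\<close> and on the relators with indices \<open>0, \<dots>, 2g\<close> are both
  the following module of coordinate functions.\<close>

definition free_module :: "(nat \<Rightarrow> gring) set" where
  "free_module = {m. \<forall>i. 2 * g < i \<longrightarrow> m i = 0}"

definition scale :: "gring \<Rightarrow> (nat \<Rightarrow> gring) \<Rightarrow> (nat \<Rightarrow> gring)" where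
  "scale a m = (\<lambda>i. a * m i)"

definition unit_vec :: "nat \<Rightarrow> nat \<Rightarrow> gring" where
  "unit_vec i = (\<lambda>j. if j = i then 1 else 0)"

definition fox_diff :: "('p \<Rightarrow> bit) \<Rightarrow> (nat \<Rightarrow> gring) \<Rightarrow> (nat \<Rightarrow> gring)" where
  "fox_diff \<phi> m =
     (\<lambda>j. \<Sum>i \<in> {0..2 * g}. m i * ring_ext piP u \<phi> (fox j (bundle_relator g c i)))"

definition im_diff :: "('p \<Rightarrow> bit) \<Rightarrow> (nat \<Rightarrow> gring) set" where
  "im_diff \<phi> = fox_diff \<phi> ` free_module"

text \<open>\<open>rel_homology \<phi>\<close> is the cokernel of \<open>fox_diff \<phi>\<close>.  It models the first mod 2 homology of the
  double covering with monodromy \<open>\<phi>\<close> relative to the fiber over the base point: the lift of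
  the loop \<open>u\<^sub>i\<close> at the base point corresponds to the class of \<open>unit_vec i\<close>, and \<open>t\<close> is the deck
  transformation.  Elements are cosets; their sum is the elementwise sum of sets.\<close>

definition cls :: "('p \<Rightarrow> bit) \<Rightarrow> (nat \<Rightarrow> gring) \<Rightarrow> (nat \<Rightarrow> gring) set" where
  "cls \<phi> m = m +o im_diff \<phi>"

definition rel_homology :: "('p \<Rightarrow> bit) \<Rightarrow> (nat \<Rightarrow> gring) set set" where
  "rel_homology \<phi> = cls \<phi> ` free_module"

definition cls_scale ::
  "('p \<Rightarrow> bit) \<Rightarrow> gring \<Rightarrow> (nat \<Rightarrow> gring) set \<Rightarrow> (nat \<Rightarrow> gring) set" where
  "cls_scale \<phi> a X = scale a ` X + im_diff \<phi>"

definition module_iso ::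
  "('p \<Rightarrow> bit) \<Rightarrow> ('p \<Rightarrow> bit) \<Rightarrow> ((nat \<Rightarrow> gring) set \<Rightarrow> (nat \<Rightarrow> gring) set) \<Rightarrow> bool" where
  "module_iso \<phi> \<phi>' \<Psi> \<longleftrightarrow>
     bij_betw \<Psi> (rel_homology \<phi>) (rel_homology \<phi>') \<and>
     (\<forall>X \<in> rel_homology \<phi>. \<forall>Y \<in> rel_homology \<phi>. \<Psi> (X + Y) = \<Psi> X + \<Psi> Y) \<and>
     (\<forall>a. \<forall>X \<in> rel_homology \<phi>. \<Psi> (cls_scale \<phi> a X) = cls_scale \<phi>' a (\<Psi> X))"

definition v_vec :: "('p \<Rightarrow> bit) \<Rightarrow> nat \<Rightarrow> nat \<Rightarrow> gring" where
  "v_vec \<phi> i = unit_vec i + scale (scalar (\<phi> (u i))) (unit_vec 0)"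

definition v_comb :: "('p \<Rightarrow> bit) \<Rightarrow> (nat \<Rightarrow> bit) \<Rightarrow> gring \<Rightarrow> nat \<Rightarrow> gring" where
  "v_comb \<phi> d y = (\<Sum>i \<in> {1..2 * g}. scale (scalar (d i)) (v_vec \<phi> i)) + scale y (unit_vec 0)"

definition proj :: "('p \<Rightarrow> bit) \<Rightarrow> (nat \<Rightarrow> gring) set \<Rightarrow> 'f set" where
  "proj \<phi> X = (THE z. \<exists>d y. X = cls \<phi> (v_comb \<phi> d y) \<and> z = comb d)"

definition star :: "('p \<Rightarrow> bit) \<Rightarrow> (nat \<Rightarrow> gring) set \<Rightarrow> (nat \<Rightarrow> gring) set \<Rightarrow> bit" where
  "star \<phi> X Y = ip (proj \<phi> X) (proj \<phi> Y)"

definition respects_star ::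
  "('p \<Rightarrow> bit) \<Rightarrow> ('p \<Rightarrow> bit) \<Rightarrow> ((nat \<Rightarrow> gring) set \<Rightarrow> (nat \<Rightarrow> gring) set) \<Rightarrow> bool" where
  "respects_star \<phi> \<phi>' \<Psi> \<longleftrightarrow>
     (\<forall>X \<in> rel_homology \<phi>. \<forall>Y \<in> rel_homology \<phi>. star \<phi>' (\<Psi> X) (\<Psi> Y) = star \<phi> X Y)"


subsection \<open>Quotient isomorphisms\<close>

definition W :: "(nat \<Rightarrow> nat \<Rightarrow> bit) \<Rightarrow> nat \<Rightarrow> bit" where
  "W A j = (\<Sum>i \<in> {1..2 * g}. A i j * r i) + (\<Sum>i \<in> {1..g}. A (2 * i) j * A (2 * i - 1) j) + r j"

text \<open>The matrix \<open>J(A)\<close>; index \<open>0\<close> belongs to \<open>u\<^sub>0\<close>, that is, to the last row and column in the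
  order \<open>u\<^sub>1, \<dots>, u\<^bsub>2g\<^esub>, u\<^sub>0\<close>.\<close>

definition J :: "(nat \<Rightarrow> nat \<Rightarrow> bit) \<Rightarrow> nat \<Rightarrow> nat \<Rightarrow> bit" where
  "J A i j =
     (if i = 0 then (if j = 0 then 1 else W A j) else (if j = 0 then 0 else A i j))"

definition psi :: "(nat \<Rightarrow> nat \<Rightarrow> bit) \<Rightarrow> (nat \<Rightarrow> gring) \<Rightarrow> (nat \<Rightarrow> gring)" where
  "psi A m = (\<lambda>i. if i \<le> 2 * g then \<Sum>j \<in> {0..2 * g}. scalar (J A i j) * m j else 0)"

text \<open>A module isomorphism is determined by its values on the generators below, so this says that
  it is the one with block matrix \<open>diag(A, 1)\<close>.\<close>

definition has_block_matrix ::
  "('p \<Rightarrow> bit) \<Rightarrow> ('p \<Rightarrow> bit) \<Rightarrow> (nat \<Rightarrow> nat \<Rightarrow> bit)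
     \<Rightarrow> ((nat \<Rightarrow> gring) set \<Rightarrow> (nat \<Rightarrow> gring) set) \<Rightarrow> bool" where
  "has_block_matrix \<phi> \<phi>' A \<Psi> \<longleftrightarrow>
     (\<forall>j \<in> {1..2 * g}. \<Psi> (cls \<phi> (v_vec \<phi> j)) = cls \<phi>' (v_comb \<phi>' (\<lambda>i. A i j) 0)) \<and>
     \<Psi> (cls \<phi> (unit_vec 0)) = cls \<phi>' (unit_vec 0)"

definition is_quotient ::
  "('p \<Rightarrow> bit) \<Rightarrow> ('p \<Rightarrow> bit) \<Rightarrow> ((nat \<Rightarrow> gring) set \<Rightarrow> (nat \<Rightarrow> gring) set) \<Rightarrow> bool" where
  "is_quotient \<phi> \<phi>' \<Psi> \<longleftrightarrow>
     module_iso \<phi> \<phi>' \<Psi> \<and> respects_star \<phi> \<phi>' \<Psi> \<and>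
     (\<exists>f A. symplectic f \<and> has_matrix f A \<and>
        (\<forall>X \<in> rel_homology \<phi>. f (proj \<phi> X) = proj \<phi>' (\<Psi> X)) \<and>
        has_block_matrix \<phi> \<phi>' A \<Psi> \<and>
        psi A ` im_diff \<phi> = im_diff \<phi>' \<and>
        (\<forall>m \<in> free_module. \<Psi> (cls \<phi> m) = cls \<phi>' (psi A m)))"

end

end

theory Submission
  imports Defs
begin

text \<open>
  Both sides of the equivalence say that a symplectic automorphism carries one quadratic form to
  another. Write \<open>n\<^sub>i = \<phi> (u i)\<close>, \<open>n'\<^sub>i = \<phi>' (u i)\<close>, and let \<open>A\<close> be the matrix of a symplectic \<open>f\<close>.
  The associated generators are \<open>v\<^sub>i = u\<^sub>i + n\<^sub>i u\<^sub>0\<close> and \<open>v'\<^sub>i = u\<^sub>i + n'\<^sub>i u\<^sub>0\<close>.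

  The composite \<open>q\<^bsub>\<phi>\<^esub> = induced_form \<phi> \<circ> s\<close> is a quadratic refinement of the intersection product,
  because \<open>s\<close> is quadratic and \<open>\<phi> (u 0) = 1\<close>. On this side, a class in the homology of the
  bundle is determined by its image in the homology of the surface together with the value of one
  special monodromy (\<open>H1_piP_eqI\<close>), and every such pair of values occurs. So one can transport along
  \<open>f\<close> by prescribing these two values; the resulting map is automatically an isomorphism whose
  composite with \<open>\<phi>'\<close> is \<open>\<phi>\<close>, and it is the lift \<open>f\<^sub>s\<close> exactly when \<open>q\<^bsub>\<phi>\<^esub>\<close> and \<open>q\<^bsub>\<phi>'\<^esub> \<circ> f\<close> agree on the symplectic basis.
  Thus \<open>\<phi>\<close> and \<open>\<phi>'\<close> are \<open>s\<close>-related iff some \<open>f\<close> satisfies this (\<open>s_related_iff\<close>). Evaluating both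
  forms on the basis (\<open>quadratic_form_comb\<close>) turns the condition into
  \<open>n\<^sub>j = (\<Sum>i. A i j * n'\<^sub>i) + W A j\<close> for all \<open>j\<close>; this is where the quadratic term of \<open>W\<close> comes from.

  On the covering side, put \<open>\<eta> = 1 + t\<close>, the norm element of the group ring. Every Fox derivative of
  a relator is a multiple of \<open>\<eta>\<close>, and the image of the boundary map consists of the vectors
  \<open>\<eta> * ((\<Sum>i. d\<^sub>i * v\<^sub>i) + e * c * u\<^sub>0)\<close> with coefficients in the field of two elements (\<open>im_diff_eq\<close>).
  Two elements of the form \<open>b * u\<^sub>0\<close> with \<open>b\<close> in the field are therefore congruent only if they are
  equal, since the augmentation kills \<open>\<eta>\<close>. Now \<open>psi A\<close> sends \<open>v\<^sub>j\<close> to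
  \<open>(\<Sum>i. A i j * v'\<^sub>i) + b * u\<^sub>0\<close> with \<open>b = n\<^sub>j + W A j + (\<Sum>i. A i j * n'\<^sub>i)\<close>. If \<open>psi A\<close> induces the map
  with block matrix \<open>diag(A, 1)\<close> then \<open>b = 0\<close>, which is the equation above
  (\<open>monodromy_matrix_if_block\<close>). If conversely the equation holds, \<open>psi A\<close> acts on the coordinates
  with respect to \<open>v\<^sub>1, \<dots>, v\<^bsub>2g\<^esub>, u\<^sub>0\<close> by \<open>diag(A, 1)\<close>, hence matches the two images, and it induces the
  quotient isomorphism (\<open>quotient_exists\<close>).
\<close>

section \<open>The group ring of the group of order two\<close>

text \<open>Without this the simplifier turns the field operations into bitwise ones, out of reach of the
  laws of rings.\<close>

declare add_bit_eq_xor [simp del] mult_bit_eq_and [simp del]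

lemma add_self: "(a::bit) + a = 0" by simp

lemma gring_add_self: "(a :: gring) + a = 0"
  by (rule poly_mapping_eqI) (simp only: lookup_add add_self lookup_zero)

lemma gring_two [simp]: "(2 :: gring) = 0"
  using gring_add_self[of 1] by (simp only: one_add_one)

lemma gring_add_cancel [simp]: "a + (a + b) = (b :: gring)"
  by (simp only: gring_add_self add_0 flip: add.assoc)

lemma gring_uminus [simp]: "- (a :: gring) = a"
  using gring_add_self[of a] by (simp only: eq_neg_iff_add_eq_0[symmetric])

lemma gring_minus [simp]: "(a :: gring) - b = a + b"
  by (simp add: diff_conv_add_uminus del: add_uminus_conv_diff)

lemma scalar_simps [simp]:
  "scalar 0 = 0" "scalar 1 = 1" "scalar (a + b) = scalar a + scalar b"
  "scalar (a * b) = scalar a * scalar b"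
  by (simp_all only: scalar_def single_add mult_single single_zero single_one add_0)

lemma scalar_sum: "scalar (sum f I) = (\<Sum>i\<in>I. scalar (f i))"
  by (induction I rule: infinite_finite_induct) auto

text \<open>The norm element \<open>1 + t\<close>, called \<open>\<eta>\<close> in the text. It generates the augmentation ideal, and since its square is \<open>2 + 2 t = 0\<close>,
  multiplying by it only sees the augmentation of the other factor.\<close>

definition norm_elt :: gring where "norm_elt = 1 + Poly_Mapping.single 1 1"

definition aug :: "gring \<Rightarrow> bit" where "aug a = Poly_Mapping.lookup a 0 + Poly_Mapping.lookup a 1"

lemma norm_elt_square [simp]: "norm_elt * norm_elt = 0" "norm_elt * (norm_elt * a) = 0"
proof -
  show *: "norm_elt * norm_elt = 0"
    by (simp add: norm_elt_def algebra_simps mult_single)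
  show "norm_elt * (norm_elt * a) = 0" by (simp add: * flip: mult.assoc)
qed

lemma aug_simps [simp]:
  "aug 0 = 0" "aug 1 = 1" "aug (a + b) = aug a + aug b" "aug (scalar e) = e" "aug norm_elt = 0"
  subgoal by (simp add: aug_def)
  subgoal by (simp add: aug_def lookup_one)
  subgoal by (simp only: aug_def lookup_add ac_simps)
  subgoal by (simp add: aug_def scalar_def lookup_single)
  subgoal by (simp add: aug_def norm_elt_def lookup_add lookup_single lookup_one)
  done

text \<open>The elements \<open>1\<close> and \<open>1 + t\<close> form a basis of the group ring, better suited than \<open>1\<close> and \<open>t\<close>
  because the coordinate at \<open>1\<close> is the augmentation.\<close>

lemma gring_decomp: "a = scalar (aug a) + scalar (Poly_Mapping.lookup a 1) * norm_elt"
proof (rule poly_mapping_eqI)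
  fix k :: bit
  show "Poly_Mapping.lookup a k = Poly_Mapping.lookup (scalar (aug a) + scalar (Poly_Mapping.lookup a 1) * norm_elt) k"
    by (cases k; cases "Poly_Mapping.lookup a 0"; cases "Poly_Mapping.lookup a 1")
       (simp_all add: norm_elt_def scalar_def aug_def distrib_left mult_single lookup_add lookup_single
      flip: single_one)
qed

lemma mult_norm_elt: "a * norm_elt = scalar (aug a) * norm_elt"
  by (subst gring_decomp) (simp add: algebra_simps)

text \<open>In the basis \<open>1, \<eta>\<close> the product of \<open>a + b \<eta>\<close> and \<open>a' + b' \<eta>\<close> is \<open>a a' + (a b' + a' b) \<eta>\<close>, as
  \<open>\<eta>\<^sup>2 = 0\<close>.\<close>

lemma aug_mult [simp]: "aug (a * b) = aug a * aug b"
proof -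
  have "a * b = scalar (aug a * aug b)
      + scalar (aug a * Poly_Mapping.lookup b 1 + Poly_Mapping.lookup a 1 * aug b) * norm_elt"
    by (subst gring_decomp[of a], subst gring_decomp[of b]) (simp add: algebra_simps)
  moreover have "aug (scalar x * norm_elt) = 0" for x
    by (cases x) auto
  ultimately show ?thesis by (simp add: aug_simps del: scalar_simps)
qed

lemma norm_elt_scalar_cancel [simp]: "scalar a * norm_elt = scalar b * norm_elt \<longleftrightarrow> a = b"
proof
  assume "scalar a * norm_elt = scalar b * norm_elt"
  hence "Poly_Mapping.lookup (scalar a * norm_elt) 0 = Poly_Mapping.lookup (scalar b * norm_elt) 0" by simp
  thus "a = b" by (simp add: norm_elt_def scalar_def distrib_left mult_single lookup_add lookup_single
      flip: single_one)
qed simp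

lemma single_one_eq: "Poly_Mapping.single b 1 = 1 + scalar b * norm_elt"
  by (cases b) (simp_all add: norm_elt_def)

lemma aug_sum: "aug (sum f I) = (\<Sum>i\<in>I. aug (f i))"
  by (induction I rule: infinite_finite_induct) auto

lemma gring_normal_form_eq_0:
  assumes "scalar a + norm_elt * scalar b = 0"
  shows "a = 0 \<and> b = 0"
proof -
  have "aug (scalar a + norm_elt * scalar b) = 0" using assms by simp
  then have "a = 0" by simp
  with assms have "scalar b * norm_elt = scalar 0 * norm_elt" by (simp add: mult.commute)
  then show ?thesis using \<open>a = 0\<close> by (simp only: norm_elt_scalar_cancel)
qed

section \<open>Fox derivatives under a homomorphism to the group of order two\<close>

lemma lookup_ring_ext: "Poly_Mapping.lookup (ring_ext G u \<phi> z) k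
    = of_int (Poly_Mapping.lookup (frag_extend (\<lambda>w. frag_of (\<phi> (word_val G u w))) z) k)"
  by (simp add: ring_ext_def map.rep_eq when_def)

lemma ring_ext_add: "ring_ext G u \<phi> (y + z) = ring_ext G u \<phi> y + ring_ext G u \<phi> z"
  by (rule poly_mapping_eqI) (simp only: lookup_ring_ext frag_extend_add lookup_add of_int_add)

lemma ring_ext_uminus: "ring_ext G u \<phi> (- z) = ring_ext G u \<phi> z"
  by (rule poly_mapping_eqI) (simp add: lookup_ring_ext frag_extend_minus)

lemma ring_ext_0: "ring_ext G u \<phi> 0 = 0"
  by (rule poly_mapping_eqI) (simp add: lookup_ring_ext)

lemma ring_ext_frag_of:
  "ring_ext G u \<phi> (frag_of w) = Poly_Mapping.single (\<phi> (word_val G u w)) 1"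
  by (rule poly_mapping_eqI) (simp add: lookup_ring_ext lookup_single when_def)

lemma keys_letter_mult:
  assumes "Poly_Mapping.keys z \<subseteq> lists S" "a \<in> S"
  shows "Poly_Mapping.keys (letter_mult a z) \<subseteq> lists S"
  using assms(1)
proof (induction rule: frag_induction)
  case (diff y z)
  then show ?case
    using keys_diff[of "letter_mult a y" "letter_mult a z"]
    by (auto simp: letter_mult_def frag_extend_diff)
qed (use assms(2) in \<open>auto simp: letter_mult_def keys_frag_of\<close>)

text \<open>A homomorphism defined on a group says nothing about words whose value is not in the carrier, so
  one has to know that Fox derivatives involve no new letters.\<close>

lemma keys_fox:
  "w \<in> lists (I \<times> UNIV) \<Longrightarrow> Poly_Mapping.keys (fox j w) \<subseteq> lists (I \<times> UNIV)"
proof (induction w)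
  case (Cons a w)
  obtain i b where a: "a = (i, b)" by (cases a)
  have *: "Poly_Mapping.keys (letter_mult a (fox j w)) \<subseteq> lists (I \<times> UNIV)"
    using Cons by (intro keys_letter_mult) auto
  let ?h = "if i = j then if b then frag_of [] else - frag_of [(i, False)] else 0"
  have "Poly_Mapping.keys ?h \<subseteq> lists (I \<times> UNIV)"
    using Cons.prems a by (auto simp: keys_frag_of)
  then show ?case
    using * keys_add[of ?h "letter_mult a (fox j w)"] a by (auto simp only: fox.simps)
qed simp

lemma sum_pairs:
  "(\<Sum>i\<in>{1..2 * h}. f i) = (\<Sum>l\<in>{1..h}. f (2 * l - 1) + f (2 * l :: nat))"
  for f :: "nat \<Rightarrow> 'a::comm_monoid_add"
  by (induction h) (simp_all add: ac_simps)

lemma word_val_closed: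
  assumes "group G" "u ` I \<subseteq> carrier G" "w \<in> lists (I \<times> UNIV)"
  shows "word_val G u w \<in> carrier G"
proof -
  interpret group G by fact
  have "u i \<in> carrier G" if "i \<in> I" for i using that assms(2) by auto
  with assms(3) show ?thesis
    by (induction w) auto
qed

text \<open>The index of the symplectically dual basis element: \<open>2 l - 1\<close> and \<open>2 l\<close> are exchanged.\<close>

definition mate :: "nat \<Rightarrow> nat" where
  "mate j = (if even j then j - 1 else j + 1)"

lemma mate_mem: "i \<in> {1..2 * h} \<Longrightarrow> mate i \<in> {1..2 * h}"
  by (auto simp: mate_def) presburger

lemma mate_mate: "1 \<le> i \<Longrightarrow> mate (mate i) = i"
  by (auto simp: mate_def)

lemma mate_eq_iff: "i \<in> {1..2 * h} \<Longrightarrow> j \<in> {1..2 * h} \<Longrightarrow>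
   (\<exists>l\<in>{1..h}. {i, j} = {2 * l - 1, 2 * l}) \<longleftrightarrow> i = mate j"
proof
  assume i: "i \<in> {1..2 * h}" and j: "j \<in> {1..2 * h}" and "i = mate j"
  then show "\<exists>l\<in>{1..h}. {i, j} = {2 * l - 1, 2 * l}"
    by (intro bexI[of _ "(j + 1) div 2"]) (auto simp: mate_def elim!: evenE oddE)
qed (auto simp: mate_def doubleton_eq_iff)

text \<open>Each pair of dual indices contributes the same product twice. This is why the multiples of \<open>u\<^sub>0\<close>
  that arise from rewriting the surface relator in terms of the \<open>v\<^sub>i\<close> cancel.\<close>

lemma sum_mate_eq_0: "(\<Sum>i\<in>{1..2 * h}. n (mate i) * n i) = (0 :: bit)"
proof -
  have "n (mate (2 * l - 1)) * n (2 * l - 1) + n (mate (2 * l)) * n (2 * l) = 0"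
    if "l \<in> {1..h}" for l
    using that by (simp add: mate_def mult.commute[of "n (2 * l - 1)"])
  then show ?thesis unfolding sum_pairs by (intro sum.neutral) blast
qed

context quadratic_section
begin

abbreviation letters :: "(nat \<times> bool) set" where "letters \<equiv> {0..2 * g} \<times> UNIV"

abbreviation fox_value :: "('p \<Rightarrow> bit) \<Rightarrow> nat \<Rightarrow> word \<Rightarrow> gring" where
  "fox_value \<phi> j w \<equiv> ring_ext piP u \<phi> (fox j w)"

lemma group_piP: "group piP"
  using piP by (simp add: presented_by_def)

lemma u_closed: "i \<le> 2 * g \<Longrightarrow> u i \<in> carrier piP"
  using piP unfolding presented_by_def by (meson atLeastAtMost_iff image_subset_iff le0)

lemma group_piF: "group piF"
  using piF by (simp add: presented_by_def)

lemma x_closed: "i \<in> {1..2 * g} \<Longrightarrow> x i \<in> carrier piF"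
  using piF unfolding presented_by_def by blast

lemma monodromy_mult:
  assumes "\<phi> \<in> special_monodromies" "a \<in> carrier piP" "b \<in> carrier piP"
  shows "\<phi> (a \<otimes>\<^bsub>piP\<^esub> b) = \<phi> a + \<phi> b"
  using assms by (auto simp: special_monodromies_def hom_def bit_group_def)

lemma monodromy_fiber: "\<phi> \<in> special_monodromies \<Longrightarrow> \<phi> (u 0) = 1"
  by (simp add: special_monodromies_def)

lemma monodromy_one: "\<phi> \<in> special_monodromies \<Longrightarrow> \<phi> \<one>\<^bsub>piP\<^esub> = 0"
  using monodromy_mult[of \<phi> "\<one>\<^bsub>piP\<^esub>" "\<one>\<^bsub>piP\<^esub>"] group_piP
  by (simp add: group.is_monoid)

lemma monodromy_inv:
  assumes "\<phi> \<in> special_monodromies" "a \<in> carrier piP"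
  shows "\<phi> (inv\<^bsub>piP\<^esub> a) = \<phi> a"
proof -
  interpret group piP by (rule group_piP)
  have "\<phi> (inv\<^bsub>piP\<^esub> a) + \<phi> a = 0"
    using monodromy_one[OF assms(1)] monodromy_mult[OF assms(1), of "inv\<^bsub>piP\<^esub> a" a] assms(2) by simp
  thus ?thesis by (cases "\<phi> a"; cases "\<phi> (inv\<^bsub>piP\<^esub> a)") auto
qed

text \<open>This and \<open>fox_value_Cons\<close> are the Fox product rule after passing to the group ring, where a letter
  and its inverse become equal.\<close>

lemma ring_ext_letter_mult:
  assumes \<phi>: "\<phi> \<in> special_monodromies" and i: "i \<le> 2 * g"
    and z: "Poly_Mapping.keys z \<subseteq> lists letters"
  shows "ring_ext piP u \<phi> (letter_mult (i, b) z)
    = Poly_Mapping.single (\<phi> (u i)) 1 * ring_ext piP u \<phi> z"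
  using z
proof (induction rule: frag_induction)
  case zero
  then show ?case by (simp add: letter_mult_def ring_ext_0)
next
  case (one w)
  interpret group piP by (rule group_piP)
  have "word_val piP u w \<in> carrier piP"
    using one group_piP by (intro word_val_closed) (auto intro: u_closed)
  then have "\<phi> (word_val piP u ((i, b) # w)) = \<phi> (u i) + \<phi> (word_val piP u w)"
    using \<phi> i u_closed[OF i] by (simp add: monodromy_mult monodromy_inv)
  then show ?case
    by (simp add: letter_mult_def ring_ext_frag_of mult_single del: word_val.simps)
next
  case (diff y z)
  have *: "ring_ext piP u \<phi> (v - w) = ring_ext piP u \<phi> v + ring_ext piP u \<phi> w" for v w
    using ring_ext_add[of piP u \<phi> v "- w"] by (simp add: ring_ext_uminus)
  from diff show ?case by (simp add: letter_mult_def frag_extend_diff * distrib_left)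
qed

lemma fox_value_Cons:
  assumes "\<phi> \<in> special_monodromies" "i \<le> 2 * g" "w \<in> lists letters"
  shows "fox_value \<phi> j ((i, b) # w) =
    (if i = j then if b then 1 else 1 + scalar (\<phi> (u i)) * norm_elt else 0)
    + (1 + scalar (\<phi> (u i)) * norm_elt) * fox_value \<phi> j w"
  using assms keys_fox[OF assms(3)] group_piP
  by (auto simp: ring_ext_add ring_ext_uminus ring_ext_0 ring_ext_letter_mult ring_ext_frag_of
      single_one_eq monodromy_inv monodromy_one u_closed group.is_monoid)

lemma fox_value_commutator_append:
  assumes \<phi>: "\<phi> \<in> special_monodromies" and i: "i \<le> 2 * g" and k: "k \<le> 2 * g"
    and w: "w \<in> lists letters"
  shows "fox_value \<phi> j (commutator_word i k @ w) =
    (if j = i then scalar (\<phi> (u k)) * norm_elt else 0) + (if j = k then scalar (\<phi> (u i)) * norm_elt else 0)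
    + fox_value \<phi> j w"
proof -
  \<comment> \<open>The images \<open>A\<close>, \<open>B\<close> of the two letters commute and are involutions, so the prefixes collapse.\<close>
  define A where "A = 1 + scalar (\<phi> (u i)) * norm_elt"
  define B where "B = 1 + scalar (\<phi> (u k)) * norm_elt"
  define I K :: gring where "I = (if i = j then 1 else 0)" and "K = (if k = j then 1 else 0)"
  have AB: "(1 + scalar e * norm_elt) * (1 + scalar e * norm_elt) = 1" for e
    by (simp add: distrib_left distrib_right mult.assoc mult.left_commute[of norm_elt])
  have cancel: "A * (A * z) = z" "B * (B * z) = z" for z
    unfolding A_def B_def using AB by (simp_all flip: mult.assoc)
  have pos: "fox_value \<phi> j ((i, True) # v) = I + A * fox_value \<phi> j v"
    "fox_value \<phi> j ((k, True) # v) = K + B * fox_value \<phi> j v"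
    "fox_value \<phi> j ((i, False) # v) = A * I + A * fox_value \<phi> j v"
    "fox_value \<phi> j ((k, False) # v) = B * K + B * fox_value \<phi> j v" if "v \<in> lists letters" for v
    using fox_value_Cons[OF \<phi>] that i k by (auto simp: A_def B_def I_def K_def simp del: fox.simps)
  have "fox_value \<phi> j (commutator_word i k @ w)
      = I + A * (K + B * (A * I + A * (B * K + B * fox_value \<phi> j w)))"
    using i k w by (simp add: commutator_word_def pos del: fox.simps)
  also have "\<dots> = (1 + B) * I + (1 + A) * K + fox_value \<phi> j w"
    by (simp add: distrib_left distrib_right cancel mult.left_commute[of B A] ac_simps)
  finally show ?thesis
    by (simp add: A_def B_def I_def K_def)
qed

lemma surface_relator_Suc:
  "surface_relator (Suc h) = surface_relator h @ commutator_word (2 * h + 1) (2 * h + 2)"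
  by (simp add: surface_relator_def)

text \<open>In a commutator \<open>[u\<^sub>i, u\<^sub>k]\<close> the derivative at either letter is \<open>1 + t\<^sup>n\<close>, where \<open>n\<close> belongs to the
  other letter. In the product of commutators the prefixes act trivially, and each letter occurs in
  one commutator only.\<close>

lemma fox_value_surface_append:
  assumes \<phi>: "\<phi> \<in> special_monodromies"
  shows "h \<le> g \<Longrightarrow> w \<in> lists letters \<Longrightarrow> fox_value \<phi> j (surface_relator h @ w) =
    (if j \<in> {1..2 * h} then scalar (\<phi> (u (mate j))) * norm_elt else 0) + fox_value \<phi> j w"
proof (induction h arbitrary: w)
  case 0
  then show ?case by (simp add: surface_relator_def)
next
  case (Suc h)
  have "commutator_word (2 * h + 1) (2 * h + 2) @ w \<in> lists letters"
    using Suc.prems by (simp add: commutator_word_def)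
  moreover have "j \<in> {1..2 * Suc h} \<longleftrightarrow> j \<in> {1..2 * h} \<or> j = 2 * h + 1 \<or> j = 2 * h + 2" by auto
  moreover have "mate (2 * h + 1) = 2 * h + 2" "mate (2 * h + 2) = 2 * h + 1"
    by (simp_all add: mate_def)
  ultimately show ?case
    using Suc.IH[of "commutator_word (2 * h + 1) (2 * h + 2) @ w"] Suc.prems
      fox_value_commutator_append[OF \<phi>, of "2 * h + 1" "2 * h + 2" w j]
    by (auto simp: surface_relator_Suc simp del: scalar_simps)
qed

text \<open>The geometric sum \<open>1 + t + \<dots> + t\<^bsup>2m-1\<^esup>\<close> consists of \<open>m\<close> copies of \<open>1 + t\<close>. For inverse
  letters the sum is multiplied by \<open>t\<close>, which does not change it.\<close>

lemma fox_value_power: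
  assumes \<phi>: "\<phi> \<in> special_monodromies"
  shows "fox_value \<phi> j (replicate (2 * m) (0, b)) = (if j = 0 then scalar (of_nat m) * norm_elt else 0)"
proof (induction m)
  case 0
  then show ?case by (simp add: ring_ext_0)
next
  case (Suc m)
  have "replicate k (0, b) \<in> lists letters" for k by (simp add: in_lists_conv_set)
  moreover have "replicate (2 * Suc m) (0, b) = (0, b) # (0, b) # replicate (2 * m) (0::nat, b)"
    by simp
  ultimately show ?case
    using Suc \<phi> by (auto simp: fox_value_Cons monodromy_fiber algebra_simps simp del: fox.simps replicate.simps mult_Suc_right)
qed

lemma fox_value_relator:
  assumes \<phi>: "\<phi> \<in> special_monodromies" and i: "i \<in> {1..2 * g}"
  shows "fox_value \<phi> j (bundle_relator g c i) =
    (if j = i then norm_elt else if j = 0 then scalar (\<phi> (u i)) * norm_elt else 0)"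
  using fox_value_commutator_append[OF \<phi>, of i 0 "[]" j] i
  by (auto simp: bundle_relator_def ring_ext_0 monodromy_fiber[OF \<phi>])

text \<open>The class of \<open>c\<close> mod 2. The absolute value is harmless: the relator contains \<open>2 \<bar>c\<bar>\<close> copies of
  \<open>u\<^sub>0\<close> or of its inverse, and both become \<open>t\<close>.\<close>

definition chern_bit :: bit where "chern_bit = of_nat (nat \<bar>c\<bar>)"

lemma fox_value_relator_0:
  assumes \<phi>: "\<phi> \<in> special_monodromies"
  shows "fox_value \<phi> j (bundle_relator g c 0) =
    (if j = 0 then scalar chern_bit * norm_elt
     else if j \<le> 2 * g then scalar (\<phi> (u (mate j))) * norm_elt else 0)"
proof -
  have p: "power_word 0 (2 * c) = replicate (2 * nat \<bar>c\<bar>) (0, 0 \<le> 2 * c)"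
    by (simp add: power_word_def abs_mult nat_mult_distrib)
  have "power_word 0 (2 * c) \<in> lists letters"
    by (simp add: p in_lists_conv_set)
  then show ?thesis
    using fox_value_surface_append[OF \<phi> order_refl, of "power_word 0 (2 * c)" j]
    by (auto simp: bundle_relator_def p fox_value_power[OF \<phi>] chern_bit_def)
qed

section \<open>The image of the boundary map\<close>

lemma v_comb_apply:
  "v_comb \<phi> d y j =
    (if j = 0 then (\<Sum>i\<in>{1..2 * g}. scalar (d i * \<phi> (u i))) + y
     else if j \<le> 2 * g then scalar (d j) else 0)"
proof -
  have "scale (scalar (d i)) (v_vec \<phi> i) j =
      (if j = 0 then scalar (d i * \<phi> (u i)) else if j = i then scalar (d i) else 0)"
    if "i \<in> {1..2 * g}" for i
    using that by (auto simp: scale_def v_vec_def unit_vec_def)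
  moreover have "(\<Sum>i\<in>I. f i) j = (\<Sum>i\<in>I. f i j)" for f :: "nat \<Rightarrow> nat \<Rightarrow> gring" and I
    by (induction I rule: infinite_finite_induct) auto
  ultimately have "v_comb \<phi> d y j = (\<Sum>i\<in>{1..2 * g}.
      if j = 0 then scalar (d i * \<phi> (u i)) else if j = i then scalar (d i) else 0)
      + (if j = 0 then y else 0)"
    by (simp add: v_comb_def scale_def unit_vec_def)
  then show ?thesis by (auto simp: sum.delta)
qed

text \<open>Every entry of the Fox matrix is a multiple of \<open>\<eta>\<close>, so only the augmentations of the coefficients
  matter. The relator \<open>R\<^sub>i\<close> is sent to \<open>\<eta> v\<^sub>i\<close> and \<open>R\<^sub>0\<close> to
  \<open>\<eta> ((\<Sum>i. n\<^bsub>mate i\<^esub> u\<^sub>i) + c u\<^sub>0)\<close>; replacing \<open>u\<^sub>i\<close> by \<open>v\<^sub>i\<close> there changes nothing, by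
  \<open>sum_mate_eq_0\<close>.\<close>

lemma fox_diff_eq:
  assumes \<phi>: "\<phi> \<in> special_monodromies" and m: "m \<in> free_module"
  shows "fox_diff \<phi> m = scale norm_elt (v_comb \<phi> (\<lambda>i. aug (m i) + aug (m 0) * \<phi> (u (mate i)))
    (scalar (aug (m 0) * chern_bit)))"
proof
  fix j
  have ins: "{0..2 * g} = insert 0 {1..2 * g}" by auto
  have split: "fox_diff \<phi> m j = m 0 * fox_value \<phi> j (bundle_relator g c 0)
      + (\<Sum>i\<in>{1..2 * g}. m i * (if j = i then norm_elt else if j = 0 then scalar (\<phi> (u i)) * norm_elt else 0))"
    unfolding fox_diff_def ins using \<phi> by (simp add: fox_value_relator del: scalar_simps)
  have norm_elt_out: "z * (scalar e * norm_elt) = norm_elt * scalar (aug z * e)" for z e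
    using mult_norm_elt[of "z * scalar e"] by (simp add: ac_simps)
  show "fox_diff \<phi> m j = scale norm_elt (v_comb \<phi> (\<lambda>i. aug (m i) + aug (m 0) * \<phi> (u (mate i)))
    (scalar (aug (m 0) * chern_bit))) j"
  proof (cases "j = 0")
    case True
    have "(\<Sum>i\<in>{1..2 * g}. (aug (m i) + aug (m 0) * \<phi> (u (mate i))) * \<phi> (u i))
        = (\<Sum>i\<in>{1..2 * g}. aug (m i) * \<phi> (u i))
          + aug (m 0) * (\<Sum>i\<in>{1..2 * g}. \<phi> (u (mate i)) * \<phi> (u i))"
      by (simp add: sum.distrib algebra_simps sum_distrib_left)
    also have "\<dots> = (\<Sum>i\<in>{1..2 * g}. aug (m i) * \<phi> (u i))"
      by (subst sum_mate_eq_0) simp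
    finally have "(\<Sum>i\<in>{1..2 * g}. scalar ((aug (m i) + aug (m 0) * \<phi> (u (mate i))) * \<phi> (u i)))
       = (\<Sum>i\<in>{1..2 * g}. scalar (aug (m i) * \<phi> (u i)))"
      by (simp flip: scalar_sum del: scalar_simps)
    moreover have "(\<Sum>i\<in>{1..2 * g}. m i * (if j = i then norm_elt else if j = 0 then scalar (\<phi> (u i)) * norm_elt else 0))
        = norm_elt * (\<Sum>i\<in>{1..2 * g}. scalar (aug (m i) * \<phi> (u i)))"
      unfolding sum_distrib_left using True by (intro sum.cong) (auto simp: norm_elt_out simp del: scalar_simps)
    ultimately show ?thesis
      using True unfolding split
      by (simp add: fox_value_relator_0[OF \<phi>] scale_def v_comb_apply norm_elt_out distrib_left add.commute
          del: scalar_simps)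
  next
    case False
    then have "(\<Sum>i\<in>{1..2 * g}. m i * (if j = i then norm_elt else if j = 0 then scalar (\<phi> (u i)) * norm_elt else 0))
        = (\<Sum>i\<in>{1..2 * g}. if j = i then norm_elt * scalar (aug (m j)) else 0)"
      using norm_elt_out[of _ 1] by (intro sum.cong) auto
    also have "\<dots> = (if j \<le> 2 * g then norm_elt * scalar (aug (m j)) else 0)"
      using False by (simp add: sum.delta)
    finally show ?thesis
      using False unfolding split
      by (auto simp: fox_value_relator_0[OF \<phi>] scale_def v_comb_apply norm_elt_out distrib_left
          simp del: scalar_simps(4) intro: add.commute)
  qed
qed

lemma v_comb_cong:
  assumes "\<And>i. i \<in> {1..2 * g} \<Longrightarrow> d i = d' i"
  shows "v_comb \<phi> d y = v_comb \<phi> d' y"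
  using assms by (auto simp: v_comb_def intro!: arg_cong2[of _ _ _ _ "(+)"] sum.cong)

lemma v_comb_closed: "v_comb \<phi> d y \<in> free_module"
  by (simp add: free_module_def v_comb_apply)

text \<open>The contribution of \<open>R\<^sub>0\<close> to the coefficients of the \<open>v\<^sub>i\<close> can be absorbed into those of the
  \<open>R\<^sub>i\<close>, so that the coefficients \<open>d\<close> and \<open>e\<close> vary independently.\<close>

lemma im_diff_eq:
  assumes \<phi>: "\<phi> \<in> special_monodromies"
  shows "im_diff \<phi> = {scale norm_elt (v_comb \<phi> d (scalar (e * chern_bit))) | d e. True}"
proof (intro equalityI subsetI)
  fix k assume "k \<in> im_diff \<phi>"
  then show "k \<in> {scale norm_elt (v_comb \<phi> d (scalar (e * chern_bit))) | d e. True}"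
    using fox_diff_eq[OF \<phi>] by (auto simp: im_diff_def)
next
  fix k assume "k \<in> {scale norm_elt (v_comb \<phi> d (scalar (e * chern_bit))) | d e. True}"
  then obtain d e where k: "k = scale norm_elt (v_comb \<phi> d (scalar (e * chern_bit)))" by blast
  \<comment> \<open>The shift by \<open>e\<close> times the dual value undoes the contribution of \<open>R\<^sub>0\<close>.\<close>
  define m :: "nat \<Rightarrow> gring" where "m i = (if i = 0 then scalar e
    else if i \<le> 2 * g then scalar (d i + e * \<phi> (u (mate i))) else 0)" for i
  have m: "m \<in> free_module" by (simp add: m_def free_module_def)
  have "v_comb \<phi> (\<lambda>i. aug (m i) + aug (m 0) * \<phi> (u (mate i))) y = v_comb \<phi> d y" for y
    by (rule v_comb_cong) (simp add: m_def del: scalar_simps)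
  then have "k = fox_diff \<phi> m"
    by (simp add: k fox_diff_eq[OF \<phi> m] del: scalar_simps) (simp add: m_def)
  then show "k \<in> im_diff \<phi>" using m by (auto simp: im_diff_def)
qed

end


section \<open>Mod 2 homology of a group\<close>

text \<open>The mod 2 homology is treated as an abstract group; unfolding products into products of cosets
  would hide the group laws.\<close>

declare mult_FactGroup [simp del] one_FactGroup [simp del]

locale elementary_two_group = comm_group +
  assumes square: "a \<in> carrier G \<Longrightarrow> a \<otimes> a = \<one>"
begin

lemma mult_self_left: "a \<in> carrier G \<Longrightarrow> b \<in> carrier G \<Longrightarrow> a \<otimes> (a \<otimes> b) = b"
  by (simp add: square flip: m_assoc)

lemma inv_self: "a \<in> carrier G \<Longrightarrow> inv a = a"
  by (simp add: inv_equality square)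

lemma bit_scale_closed [simp]: "a \<in> carrier G \<Longrightarrow> bit_scale G e a \<in> carrier G"
  by (simp add: bit_scale_def)

lemma bit_scale_add:
  "a \<in> carrier G \<Longrightarrow> bit_scale G (e + e') a = bit_scale G e a \<otimes> bit_scale G e' a"
  by (cases e; cases e') (simp_all add: bit_scale_def square)

lemma bit_scale_simps [simp]: "bit_scale G 0 a = \<one>" "bit_scale G 1 a = a"
  by (simp_all add: bit_scale_def)

end

lemma elementary_two_group_bit_group: "elementary_two_group bit_group"
proof -
  have "group bit_group"
    by (rule groupI) (auto simp: bit_group_def add_self ac_simps intro: exI[of "\<lambda>y. _ + y = (0::bit)", OF add_self])
  then show ?thesis
    by (intro elementary_two_group.intro group.group_comm_groupI elementary_two_group_axioms.intro)
       (auto simp: bit_group_def ac_simps)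
qed

context group
begin

lemma mod2_kernel_generators:
  "derived G (carrier G) \<union> {a \<otimes> a | a. a \<in> carrier G} \<subseteq> carrier G"
  using derived_in_carrier[of "carrier G"] by auto

lemma subgroup_mod2_kernel: "subgroup (mod2_kernel G) G"
  unfolding mod2_kernel_def by (rule generate_is_subgroup[OF mod2_kernel_generators])

lemma commutator_in_mod2_kernel:
  assumes "a \<in> carrier G" "b \<in> carrier G"
  shows "a \<otimes> b \<otimes> inv a \<otimes> inv b \<in> mod2_kernel G"
proof -
  have "a \<otimes> b \<otimes> inv a \<otimes> inv b \<in> derived G (carrier G)"
    unfolding derived_def using assms by (intro generate.incl) blast
  then show ?thesis by (auto simp: mod2_kernel_def intro: generate.incl)
qed

lemma square_in_mod2_kernel: "a \<in> carrier G \<Longrightarrow> a \<otimes> a \<in> mod2_kernel G"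
  by (auto simp: mod2_kernel_def intro: generate.incl)

text \<open>A subgroup that contains all commutators is normal: a conjugate of \<open>k\<close> by \<open>y\<close> is \<open>[y, k] k\<close>.\<close>

lemma normal_mod2_kernel: "mod2_kernel G \<lhd> G"
proof (rule normal_invI[OF subgroup_mod2_kernel])
  fix y k assume y: "y \<in> carrier G" and k: "k \<in> mod2_kernel G"
  then have "k \<in> carrier G" using subgroup.subset[OF subgroup_mod2_kernel] by auto
  moreover have "y \<otimes> k \<otimes> inv y \<otimes> inv k \<otimes> k \<in> mod2_kernel G"
    using y k calculation
    by (intro subgroup.m_closed[OF subgroup_mod2_kernel] commutator_in_mod2_kernel)
  ultimately show "y \<otimes> k \<otimes> inv y \<in> mod2_kernel G"
    using y by (simp add: m_assoc)
qed

lemma hurewicz_hom: "hurewicz G \<in> hom G (H1 G)"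
  using normal.r_coset_hom_Mod[OF normal_mod2_kernel] by (simp add: hurewicz_def[abs_def])

lemma carrier_H1: "carrier (H1 G) = hurewicz G ` carrier G"
  by (simp add: carrier_FactGroup hurewicz_def[abs_def])

lemma group_H1: "group (H1 G)"
  by (rule normal.factorgroup_is_group[OF normal_mod2_kernel])

lemma hurewicz_mult:
  "a \<in> carrier G \<Longrightarrow> b \<in> carrier G \<Longrightarrow> hurewicz G (a \<otimes> b) = hurewicz G a \<otimes>\<^bsub>H1 G\<^esub> hurewicz G b"
  using hurewicz_hom by (simp add: hom_def)

lemma hurewicz_closed: "a \<in> carrier G \<Longrightarrow> hurewicz G a \<in> carrier (H1 G)"
  using hurewicz_hom by (auto simp: hom_def)

lemma hurewicz_eq_one: "a \<in> mod2_kernel G \<Longrightarrow> hurewicz G a = \<one>\<^bsub>H1 G\<^esub>"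
  using subgroup.rcos_const[OF subgroup_mod2_kernel is_group]
  by (simp add: hurewicz_def one_FactGroup)

lemma elementary_two_group_H1: "elementary_two_group (H1 G)"
proof (intro elementary_two_group.intro group.group_comm_groupI[OF group_H1]
    elementary_two_group_axioms.intro)
  interpret H: group "H1 G" by (rule group_H1)
  interpret h: group_hom G "H1 G" "hurewicz G"
    by unfold_locales (rule hurewicz_hom)
  show sq: "a \<otimes>\<^bsub>H1 G\<^esub> a = \<one>\<^bsub>H1 G\<^esub>" if "a \<in> carrier (H1 G)" for a
    using that by (auto simp: carrier_H1 square_in_mod2_kernel hurewicz_eq_one simp flip: hurewicz_mult)
  fix y z assume "y \<in> carrier (H1 G)" "z \<in> carrier (H1 G)"
  then obtain a b where ab: "a \<in> carrier G" "b \<in> carrier G" "y = hurewicz G a" "z = hurewicz G b"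
    by (auto simp: carrier_H1)
  have "hurewicz G (a \<otimes> b \<otimes> inv a \<otimes> inv b) = \<one>\<^bsub>H1 G\<^esub>"
    using ab by (simp add: hurewicz_eq_one commutator_in_mod2_kernel)
  then have "hurewicz G (a \<otimes> b \<otimes> inv a \<otimes> inv b) \<otimes>\<^bsub>H1 G\<^esub> hurewicz G (b \<otimes> a) = hurewicz G (b \<otimes> a)"
    using ab by (simp add: hurewicz_closed)
  then have "hurewicz G (a \<otimes> b \<otimes> inv a \<otimes> inv b \<otimes> (b \<otimes> a)) = hurewicz G (b \<otimes> a)"
    using ab by (simp only: hurewicz_mult m_closed inv_closed)
  moreover have "a \<otimes> b \<otimes> inv a \<otimes> inv b \<otimes> (b \<otimes> a) = a \<otimes> b"
    using ab by (metis m_assoc m_closed inv_closed inv_mult_group l_inv r_one)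
  ultimately show "y \<otimes>\<^bsub>H1 G\<^esub> z = z \<otimes>\<^bsub>H1 G\<^esub> y"
    using ab by (simp add: hurewicz_mult)
qed

text \<open>The universal property of mod 2 homology: commutators and squares die in every elementary abelian
  2-group, so they generate a subgroup of the kernel.\<close>

lemma hom_factors_through_hurewicz:
  assumes A: "elementary_two_group A" and h: "h \<in> hom G A"
    and ab: "a \<in> carrier G" "b \<in> carrier G" "hurewicz G a = hurewicz G b"
  shows "h a = h b"
proof -
  interpret A: elementary_two_group A by fact
  interpret h: group_hom G A h by unfold_locales (rule h)
  have "h (y \<otimes> z \<otimes> inv y \<otimes> inv z) = \<one>\<^bsub>A\<^esub>" if "y \<in> carrier G" "z \<in> carrier G" for y z
    using that by (simp add: A.inv_self A.m_ac A.square A.mult_self_left)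
  then have "derived_set G (carrier G) \<subseteq> kernel G A h" by (auto simp: kernel_def)
  then have "derived G (carrier G) \<subseteq> kernel G A h"
    unfolding derived_def by (rule generate_subgroup_incl[OF _ h.subgroup_kernel])
  moreover have "{a \<otimes> a | a. a \<in> carrier G} \<subseteq> kernel G A h"
    by (auto simp: kernel_def A.square)
  ultimately have K: "mod2_kernel G \<subseteq> kernel G A h"
    unfolding mod2_kernel_def by (intro generate_subgroup_incl[OF _ h.subgroup_kernel]) auto
  have "a \<in> hurewicz G b"
    using ab rcos_self[OF ab(1) subgroup_mod2_kernel]
    by (auto simp: hurewicz_def)
  then obtain k where "k \<in> mod2_kernel G" "a = k \<otimes> b"
    by (auto simp: hurewicz_def r_coset_def)
  then show ?thesis using K ab by (auto simp: kernel_def)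
qed

text \<open>The induced map on classes, in the form used by \<open>induced_form\<close>: the homomorphism is constant on
  each coset, and one picks out the only value.\<close>

lemma the_elem_image_hurewicz:
  assumes A: "elementary_two_group A" and h: "h \<in> hom G A" and a: "a \<in> carrier G"
  shows "the_elem (h ` hurewicz G a) = h a"
proof -
  have "h ` hurewicz G a = {h a}"
  proof -
    have "a \<in> hurewicz G a"
      using rcos_self[OF a subgroup_mod2_kernel] by (simp add: hurewicz_def)
    moreover have "h b = h a" if b: "b \<in> hurewicz G a" for b
    proof -
      have "b \<in> carrier G"
        using b r_coset_subset_G[OF subgroup.subset[OF subgroup_mod2_kernel] a]
        by (auto simp: hurewicz_def)
      moreover have "hurewicz G b = hurewicz G a"
        using repr_independence[OF _ a subgroup_mod2_kernel, of b] b by (simp add: hurewicz_def)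
      ultimately show ?thesis
        using hom_factors_through_hurewicz[OF A h _ a] by blast
    qed
    ultimately show ?thesis by blast
  qed
  then show ?thesis by simp
qed

text \<open>Induction over words in the generators. No separate case for inverses is needed, since every
  homology class is its own inverse.\<close>

lemma H1_induct [consumes 3, case_names generator one mult]:
  assumes gen: "carrier G = word_val G v ` lists (I \<times> UNIV)" and v: "v ` I \<subseteq> carrier G"
    and z: "z \<in> carrier (H1 G)"
    and generator: "\<And>i. i \<in> I \<Longrightarrow> P (hurewicz G (v i))"
    and one: "P \<one>\<^bsub>H1 G\<^esub>"
    and mult: "\<And>y z. y \<in> carrier (H1 G) \<Longrightarrow> z \<in> carrier (H1 G) \<Longrightarrow> P y \<Longrightarrow> P z \<Longrightarrow> P (y \<otimes>\<^bsub>H1 G\<^esub> z)"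
  shows "P z"
proof -
  interpret H: elementary_two_group "H1 G" by (rule elementary_two_group_H1)
  interpret h: group_hom G "H1 G" "hurewicz G"
    by unfold_locales (rule hurewicz_hom)
  have "w \<in> lists (I \<times> UNIV) \<Longrightarrow> P (hurewicz G (word_val G v w))" for w
  proof (induction w)
    case Nil
    then show ?case using one by simp
  next
    case (Cons a w)
    obtain i b where a: "a = (i, b)" by (cases a)
    with Cons have i: "i \<in> I" and w: "w \<in> lists (I \<times> UNIV)" by auto
    have vi: "v i \<in> carrier G" using v i by auto
    have "hurewicz G (inv (v i)) = hurewicz G (v i)"
      using vi by (simp add: H.inv_self)
    then have "hurewicz G (word_val G v (a # w)) = hurewicz G (v i) \<otimes>\<^bsub>H1 G\<^esub> hurewicz G (word_val G v w)"
      using vi word_val_closed[OF is_group v w] by (simp add: a)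
    then show ?case
      using mult[OF h.hom_closed[OF vi] h.hom_closed[OF word_val_closed[OF is_group v w]]]
        generator[OF i] Cons.IH[OF w] by simp
  qed
  with z gen show ?thesis by (auto simp: carrier_H1)
qed

end


section \<open>Coordinates on the homology of the surface\<close>

context quadratic_section
begin

interpretation F: elementary_two_group "H1 piF"
  by (rule group.elementary_two_group_H1[OF group_piF])

interpretation P: elementary_two_group "H1 piP"
  by (rule group.elementary_two_group_H1[OF group_piP])

lemma \<sigma>_closed [simp]: "i \<in> {1..2 * g} \<Longrightarrow> \<sigma> i \<in> carrier (H1 piF)"
  unfolding \<sigma>_def by (intro group.hurewicz_closed[OF group_piF] x_closed)

lemma \<nu>_closed [simp]: "i \<le> 2 * g \<Longrightarrow> \<nu> i \<in> carrier (H1 piP)"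
  unfolding \<nu>_def by (intro group.hurewicz_closed[OF group_piP] u_closed)

declare s_closed [simp]

lemma comb_closed [simp]: "comb d \<in> carrier (H1 piF)"
  unfolding comb_def by (rule F.finprod_closed) auto

lemma comb_cong: "(\<And>i. i \<in> {1..2 * g} \<Longrightarrow> d i = e i) \<Longrightarrow> comb d = comb e"
  unfolding comb_def by (rule F.finprod_cong') auto

lemma comb_add: "comb (\<lambda>i. d i + e i) = comb d \<otimes>\<^bsub>H1 piF\<^esub> comb e"
proof -
  have "comb (\<lambda>i. d i + e i) = (\<Otimes>\<^bsub>H1 piF\<^esub>i\<in>{1..2 * g}.
      bit_scale (H1 piF) (d i) (\<sigma> i) \<otimes>\<^bsub>H1 piF\<^esub> bit_scale (H1 piF) (e i) (\<sigma> i))"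
    unfolding comb_def by (rule F.finprod_cong') (auto simp: F.bit_scale_add)
  then show ?thesis by (simp add: comb_def F.finprod_multf)
qed

lemma comb_zero: "comb (\<lambda>i. 0) = \<one>\<^bsub>H1 piF\<^esub>"
  by (simp add: comb_def)

lemma comb_single:
  assumes j: "j \<in> {1..2 * g}"
  shows "comb (\<lambda>i. if i = j then e else 0) = bit_scale (H1 piF) e (\<sigma> j)"
proof -
  have "comb (\<lambda>i. if i = j then e else 0)
      = (\<Otimes>\<^bsub>H1 piF\<^esub>i\<in>{1..2 * g}. if j = i then bit_scale (H1 piF) e (\<sigma> i) else \<one>\<^bsub>H1 piF\<^esub>)"
    unfolding comb_def by (rule F.finprod_cong') auto
  also have "\<dots> = bit_scale (H1 piF) e (\<sigma> j)"
    using j by (intro F.finprod_singleton) auto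
  finally show ?thesis .
qed

text \<open>Together with \<open>comb_inject\<close> this says that the \<open>\<sigma> i\<close> form a basis. Spanning follows from the
  presentation, independence from the nondegeneracy of the intersection product: pairing with the
  dual basis element recovers each coordinate (\<open>ip_comb_\<sigma>\<close>).\<close>

lemma comb_exists:
  assumes "z \<in> carrier (H1 piF)"
  shows "\<exists>d. z = comb d"
proof -
  have gen: "carrier piF = word_val piF x ` lists ({1..2 * g} \<times> UNIV)"
    using piF by (simp add: presented_by_def)
  have "x ` {1..2 * g} \<subseteq> carrier piF" using x_closed by auto
  from gen this assms show ?thesis
  proof (induction rule: group.H1_induct[OF group_piF, consumes 3, case_names generator one mult])
    case (generator i)
    then show ?case using comb_single[of i 1] by (auto simp: \<sigma>_def intro: exI sym)
  next
    case one
    show ?case using comb_zero by (auto intro: exI sym)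
  next
    case (mult y z)
    then obtain d e where "y = comb d" "z = comb e" by blast
    then show ?case using comb_add[of d e] by (auto intro: exI sym)
  qed
qed

lemma ip_one:
  assumes "b \<in> carrier (H1 piF)"
  shows "ip \<one>\<^bsub>H1 piF\<^esub> b = 0" "ip b \<one>\<^bsub>H1 piF\<^esub> = 0"
  using ip_left[of "\<one>\<^bsub>H1 piF\<^esub>" "\<one>\<^bsub>H1 piF\<^esub>" b] ip_right[of "\<one>\<^bsub>H1 piF\<^esub>" "\<one>\<^bsub>H1 piF\<^esub>" b] assms
  by auto

lemma ip_bit_scale:
  assumes "a \<in> carrier (H1 piF)" "b \<in> carrier (H1 piF)"
  shows "ip (bit_scale (H1 piF) e a) b = e * ip a b" "ip b (bit_scale (H1 piF) e a) = e * ip b a"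
  using assms by (cases e; simp add: ip_one)+

lemma ip_\<sigma>: "i \<in> {1..2 * g} \<Longrightarrow> j \<in> {1..2 * g} \<Longrightarrow> ip (\<sigma> i) (\<sigma> j) = (if i = mate j then 1 else 0)"
  unfolding \<sigma>_def using ip_basis[of i j] mate_eq_iff[of i g j] by simp

lemma ip_comb_\<sigma>:
  assumes j: "j \<in> {1..2 * g}"
  shows "ip (comb d) (\<sigma> j) = d (mate j)"
proof -
  have *: "ip (\<Otimes>\<^bsub>H1 piF\<^esub>i\<in>S. bit_scale (H1 piF) (d i) (\<sigma> i)) (\<sigma> j) = (\<Sum>i\<in>S. d i * ip (\<sigma> i) (\<sigma> j))"
    if "finite S" "S \<subseteq> {1..2 * g}" for S
    using that
  proof (induction S rule: finite_induct)
    case empty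
    then show ?case using j by (simp add: ip_one)
  next
    case (insert i S)
    have cl: "(\<lambda>i. bit_scale (H1 piF) (d i) (\<sigma> i)) \<in> S \<rightarrow> carrier (H1 piF)"
      using insert.prems by auto
    show ?case using insert cl j
      by (simp add: F.finprod_insert ip_left ip_bit_scale F.finprod_closed[OF cl])
  qed
  have "ip (comb d) (\<sigma> j) = (\<Sum>i\<in>{1..2 * g}. d i * ip (\<sigma> i) (\<sigma> j))"
    unfolding comb_def by (rule *) auto
  also have "\<dots> = (\<Sum>i\<in>{1..2 * g}. if i = mate j then d (mate j) else 0)"
    using j by (intro sum.cong) (auto simp: ip_\<sigma>)
  also have "\<dots> = d (mate j)"
    using mate_mem[OF j] by (simp add: sum.delta)
  finally show ?thesis .
qed

lemma comb_inject:
  assumes "comb d = comb e" "i \<in> {1..2 * g}"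
  shows "d i = e i"
  using ip_comb_\<sigma>[OF mate_mem[OF assms(2)]] assms mate_mate[of i] by (metis atLeastAtMost_iff)

lemma matrix_apply:
  assumes f: "f \<in> hom (H1 piF) (H1 piF)" and A: "has_matrix f A"
  shows "f (comb d) = comb (\<lambda>i. \<Sum>j\<in>{1..2 * g}. A i j * d j)"
proof -
  interpret f: group_hom "H1 piF" "H1 piF" f
    by unfold_locales (rule f)
  have "f (\<Otimes>\<^bsub>H1 piF\<^esub>j\<in>S. bit_scale (H1 piF) (d j) (\<sigma> j)) = comb (\<lambda>i. \<Sum>j\<in>S. A i j * d j)"
    if "finite S" "S \<subseteq> {1..2 * g}" for S
    using that
  proof (induction S rule: finite_induct)
    case empty
    then show ?case by (simp add: comb_zero)
  next
    case (insert j S)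
    have cl: "(\<lambda>i. bit_scale (H1 piF) (d i) (\<sigma> i)) \<in> S \<rightarrow> carrier (H1 piF)"
      using insert.prems by auto
    have "f (bit_scale (H1 piF) (d j) (\<sigma> j)) = comb (\<lambda>i. A i j * d j)"
      using A insert.prems by (cases "d j") (simp_all add: comb_zero has_matrix_def)
    then show ?case using insert cl
      by (simp add: F.finprod_insert F.finprod_closed[OF cl] comb_add)
  qed
  from this[of "{1..2 * g}"] show ?thesis by (simp add: comb_def)
qed

section \<open>The quadratic section and the relation that it defines\<close>

lemma induced_form_hurewicz:
  assumes "\<phi> \<in> special_monodromies" "a \<in> carrier piP"
  shows "induced_form \<phi> (hurewicz piP a) = \<phi> a"
  unfolding induced_form_def using assms
  by (intro group.the_elem_image_hurewicz[OF group_piP elementary_two_group_bit_group])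
     (auto simp: special_monodromies_def)

lemma induced_form_mult:
  assumes "\<phi> \<in> special_monodromies" "y \<in> carrier (H1 piP)" "z \<in> carrier (H1 piP)"
  shows "induced_form \<phi> (y \<otimes>\<^bsub>H1 piP\<^esub> z) = induced_form \<phi> y + induced_form \<phi> z"
proof -
  interpret group piP by (rule group_piP)
  show ?thesis using assms
    by (auto simp: carrier_H1 induced_form_hurewicz monodromy_mult simp flip: hurewicz_mult)
qed

lemma induced_form_\<nu>:
  "\<phi> \<in> special_monodromies \<Longrightarrow> i \<le> 2 * g \<Longrightarrow> induced_form \<phi> (\<nu> i) = \<phi> (u i)"
  by (simp add: \<nu>_def induced_form_hurewicz u_closed)

lemma induced_form_one: "\<phi> \<in> special_monodromies \<Longrightarrow> induced_form \<phi> \<one>\<^bsub>H1 piP\<^esub> = 0"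
  using induced_form_mult[of \<phi> "\<one>\<^bsub>H1 piP\<^esub>" "\<one>\<^bsub>H1 piP\<^esub>"] by simp

lemma induced_form_fiber:
  "\<phi> \<in> special_monodromies \<Longrightarrow> induced_form \<phi> (bit_scale (H1 piP) e (\<nu> 0)) = e"
  by (cases e) (simp_all add: induced_form_\<nu> monodromy_fiber induced_form_one)

text \<open>The map on mod 2 homology induced by the bundle projection.\<close>

definition pushforward :: "'p set \<Rightarrow> 'f set" where
  "pushforward C = the_elem ((hurewicz piF \<circ> p) ` C)"

lemma pushforward_hurewicz:
  assumes "a \<in> carrier piP"
  shows "pushforward (hurewicz piP a) = hurewicz piF (p a)"
proof -
  have "hurewicz piF \<circ> p \<in> hom piP (H1 piF)"
    using Group.hom_compose[OF p_hom group.hurewicz_hom[OF group_piF]] .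
  from group.the_elem_image_hurewicz[OF group_piP F.elementary_two_group_axioms this assms]
  show ?thesis by (simp add: pushforward_def)
qed

lemma pushforward_closed [simp]:
  "z \<in> carrier (H1 piP) \<Longrightarrow> pushforward z \<in> carrier (H1 piF)"
  using p_hom by (auto simp: group.carrier_H1[OF group_piP] pushforward_hurewicz hom_def
      intro!: group.hurewicz_closed[OF group_piF])

lemma pushforward_mult:
  assumes "y \<in> carrier (H1 piP)" "z \<in> carrier (H1 piP)"
  shows "pushforward (y \<otimes>\<^bsub>H1 piP\<^esub> z) = pushforward y \<otimes>\<^bsub>H1 piF\<^esub> pushforward z"
proof -
  interpret pF: group piF by (rule group_piF)
  interpret pP: group piP by (rule group_piP)
  interpret p: group_hom piP piF p by unfold_locales (rule p_hom)
  show ?thesis using assms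
    by (auto simp: pP.carrier_H1 pushforward_hurewicz pF.hurewicz_mult simp flip: pP.hurewicz_mult)
qed

lemma pushforward_one: "pushforward \<one>\<^bsub>H1 piP\<^esub> = \<one>\<^bsub>H1 piF\<^esub>"
  using pushforward_mult[of "\<one>\<^bsub>H1 piP\<^esub>" "\<one>\<^bsub>H1 piP\<^esub>"] by (simp add: F.square)

lemma hurewicz_piF_one: "hurewicz piF \<one>\<^bsub>piF\<^esub> = \<one>\<^bsub>H1 piF\<^esub>"
  by (intro group.hurewicz_eq_one[OF group_piF] subgroup.one_closed
      group.subgroup_mod2_kernel[OF group_piF])

lemma pushforward_fiber: "pushforward (bit_scale (H1 piP) e (\<nu> 0)) = \<one>\<^bsub>H1 piF\<^esub>"
  by (cases e) (simp_all add: pushforward_one \<nu>_def pushforward_hurewicz u_closed p_fiber hurewicz_piF_one)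

lemma s_mult:
  "a \<in> carrier (H1 piF) \<Longrightarrow> b \<in> carrier (H1 piF) \<Longrightarrow>
    s (a \<otimes>\<^bsub>H1 piF\<^esub> b) = s a \<otimes>\<^bsub>H1 piP\<^esub> s b \<otimes>\<^bsub>H1 piP\<^esub> bit_scale (H1 piP) (ip a b) (\<nu> 0)"
  unfolding \<nu>_def by (rule s_quadratic)

lemma s_\<sigma>: "i \<in> {1..2 * g} \<Longrightarrow> s (\<sigma> i) = \<nu> i \<otimes>\<^bsub>H1 piP\<^esub> bit_scale (H1 piP) (r i) (\<nu> 0)"
  unfolding \<nu>_def \<sigma>_def by (rule s_basis)

lemma s_one: "s \<one>\<^bsub>H1 piF\<^esub> = \<one>\<^bsub>H1 piP\<^esub>"
  using s_mult[of "\<one>\<^bsub>H1 piF\<^esub>" "\<one>\<^bsub>H1 piF\<^esub>"] by (simp add: P.square ip_one)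

text \<open>Although \<open>s\<close> is not additive, its failure to be additive is a multiple of the fiber class, which the
  projection kills. So \<open>pushforward \<circ> s\<close> is additive, and it fixes the basis.\<close>

lemma pushforward_s:
  assumes "a \<in> carrier (H1 piF)"
  shows "pushforward (s a) = a"
proof -
  have gen: "carrier piF = word_val piF x ` lists ({1..2 * g} \<times> UNIV)"
    using piF by (simp add: presented_by_def)
  have "x ` {1..2 * g} \<subseteq> carrier piF" using x_closed by auto
  from gen this assms show ?thesis
  proof (induction rule: group.H1_induct[OF group_piF, consumes 3, case_names generator one mult])
    case (generator i)
    have "pushforward (\<nu> i) = \<sigma> i"
      using generator by (simp add: \<nu>_def \<sigma>_def pushforward_hurewicz u_closed p_gen)
    then show ?case
      using generator by (simp add: s_\<sigma> pushforward_mult pushforward_fiber flip: \<sigma>_def)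
  next
    case one
    then show ?case by (simp add: s_one pushforward_one)
  next
    case (mult y z)
    then show ?case by (simp add: s_mult pushforward_mult pushforward_fiber)
  qed
qed

text \<open>Every generator is of this form, and these classes are closed under addition because the defect of
  additivity of \<open>s\<close> is again a multiple of the fiber class.\<close>

lemma section_normal_form:
  assumes "z \<in> carrier (H1 piP)"
  shows "\<exists>a\<in>carrier (H1 piF). \<exists>e. z = s a \<otimes>\<^bsub>H1 piP\<^esub> bit_scale (H1 piP) e (\<nu> 0)"
proof -
  have gen: "carrier piP = word_val piP u ` lists ({0..2 * g} \<times> UNIV)"
    using piP by (simp add: presented_by_def)
  have "u ` {0..2 * g} \<subseteq> carrier piP" using u_closed by auto
  from gen this assms show ?thesis
  proof (induction rule: group.H1_induct[OF group_piP, consumes 3, case_names generator one mult])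
    case (generator i)
    show ?case
    proof (cases "i = 0")
      case True
      then show ?thesis
        by (intro bexI[of _ "\<one>\<^bsub>H1 piF\<^esub>"] exI[of _ 1]) (simp_all add: s_one flip: \<nu>_def)
    next
      case False
      with generator have i: "i \<in> {1..2 * g}" by simp
      then show ?thesis
        by (intro bexI[of _ "\<sigma> i"] exI[of _ "r i"])
           (simp_all add: s_\<sigma> P.m_assoc P.square flip: \<nu>_def)
    qed
  next
    case one
    show ?case
      by (intro bexI[of _ "\<one>\<^bsub>H1 piF\<^esub>"] exI[of _ 0]) (simp_all add: s_one)
  next
    case (mult y z)
    then obtain a d b e where ab: "a \<in> carrier (H1 piF)" "b \<in> carrier (H1 piF)"
      "y = s a \<otimes>\<^bsub>H1 piP\<^esub> bit_scale (H1 piP) d (\<nu> 0)" "z = s b \<otimes>\<^bsub>H1 piP\<^esub> bit_scale (H1 piP) e (\<nu> 0)"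
      by blast
    then show ?case
      by (intro bexI[of _ "a \<otimes>\<^bsub>H1 piF\<^esub> b"] exI[of _ "d + e + ip a b"])
         (simp_all add: s_mult P.bit_scale_add P.m_ac P.square P.mult_self_left)
  qed
qed

text \<open>In the normal form \<open>s a + e \<nu>\<^sub>0\<close> the projection reads off \<open>a\<close>; a special monodromy takes the value
  \<open>1\<close> on \<open>\<nu>\<^sub>0\<close> and then reads off \<open>e\<close>. Every special monodromy thus splits the homology of the bundle
  as the homology of the surface plus one bit.\<close>

lemma H1_piP_eqI:
  assumes \<phi>: "\<phi> \<in> special_monodromies"
    and yz: "y \<in> carrier (H1 piP)" "z \<in> carrier (H1 piP)"
    and "pushforward y = pushforward z" "induced_form \<phi> y = induced_form \<phi> z"
  shows "y = z"
proof -
  obtain a d b e where ab: "a \<in> carrier (H1 piF)" "b \<in> carrier (H1 piF)"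
    "y = s a \<otimes>\<^bsub>H1 piP\<^esub> bit_scale (H1 piP) d (\<nu> 0)" "z = s b \<otimes>\<^bsub>H1 piP\<^esub> bit_scale (H1 piP) e (\<nu> 0)"
    using section_normal_form yz by meson
  then have "a = b"
    using assms(4) by (simp add: pushforward_mult pushforward_s pushforward_fiber)
  moreover from this have "d = e"
    using assms(5) ab by (simp add: induced_form_mult[OF \<phi>] induced_form_fiber[OF \<phi>])
  ultimately show ?thesis using ab by simp
qed

text \<open>The relation is a statement about the quadratic forms \<open>induced_form \<phi> \<circ> s\<close>. For the direction from
  the forms to the relation, the splittings belonging to \<open>\<phi>\<close> and \<open>\<phi>'\<close> are used to define \<open>F\<close>: it acts
  as \<open>f\<close> on the surface part and as the identity on the bit. Such a map is an isomorphism with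
  \<open>\<phi> = \<phi>' \<circ> F\<close> for any symplectic \<open>f\<close>; the hypothesis on the forms is what makes it commute with
  \<open>s\<close> on the basis.\<close>

lemma s_related_iff:
  assumes \<phi>: "\<phi> \<in> special_monodromies" and \<phi>': "\<phi>' \<in> special_monodromies"
  shows "s_related \<phi> \<phi>' \<longleftrightarrow> (\<exists>f. symplectic f \<and>
    (\<forall>j\<in>{1..2 * g}. induced_form \<phi> (s (\<sigma> j)) = induced_form \<phi>' (s (f (\<sigma> j)))))"
proof
  assume "s_related \<phi> \<phi>'"
  then show "\<exists>f. symplectic f \<and>
    (\<forall>j\<in>{1..2 * g}. induced_form \<phi> (s (\<sigma> j)) = induced_form \<phi>' (s (f (\<sigma> j))))"
    unfolding s_related_def is_lift_def by fastforce
next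
  assume "\<exists>f. symplectic f \<and>
    (\<forall>j\<in>{1..2 * g}. induced_form \<phi> (s (\<sigma> j)) = induced_form \<phi>' (s (f (\<sigma> j))))"
  then obtain f where f: "symplectic f"
    and q: "\<And>j. j \<in> {1..2 * g} \<Longrightarrow> induced_form \<phi> (s (\<sigma> j)) = induced_form \<phi>' (s (f (\<sigma> j)))"
    by blast
  from f have f_iso: "f \<in> hom (H1 piF) (H1 piF)" "bij_betw f (carrier (H1 piF)) (carrier (H1 piF))"
    by (auto simp: symplectic_def iso_def)
  interpret f: group_hom "H1 piF" "H1 piF" f
    by unfold_locales (rule f_iso)
  have split: "\<exists>z\<in>carrier (H1 piP). pushforward z = a \<and> induced_form \<chi> z = e"
    if "\<chi> \<in> special_monodromies" "a \<in> carrier (H1 piF)" for \<chi> a e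
    using that
    by (intro bexI[of _ "s a \<otimes>\<^bsub>H1 piP\<^esub> bit_scale (H1 piP) (induced_form \<chi> (s a) + e) (\<nu> 0)"])
       (simp_all add: pushforward_mult pushforward_s pushforward_fiber induced_form_mult
         induced_form_fiber add_self flip: add.assoc)
  then have "\<forall>z\<in>carrier (H1 piP). \<exists>y\<in>carrier (H1 piP).
      pushforward y = f (pushforward z) \<and> induced_form \<phi>' y = induced_form \<phi> z"
    using \<phi>' by simp
  then obtain F where F: "\<And>z. z \<in> carrier (H1 piP) \<Longrightarrow> F z \<in> carrier (H1 piP)"
      "\<And>z. z \<in> carrier (H1 piP) \<Longrightarrow> pushforward (F z) = f (pushforward z)"
      "\<And>z. z \<in> carrier (H1 piP) \<Longrightarrow> induced_form \<phi>' (F z) = induced_form \<phi> z"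
    by metis
  note eqI = H1_piP_eqI[OF \<phi>'] and eqI' = H1_piP_eqI[OF \<phi>]
  have "F \<in> hom (H1 piP) (H1 piP)"
    by (intro homI eqI) (simp_all add: F pushforward_mult induced_form_mult \<phi> \<phi>')
  moreover have "inj_on F (carrier (H1 piP))"
  proof (rule inj_onI)
    fix y z assume "y \<in> carrier (H1 piP)" "z \<in> carrier (H1 piP)" "F y = F z"
    then show "y = z"
      using F(2,3) f_iso(2) by (metis eqI' bij_betw_imp_inj_on inj_onD pushforward_closed)
  qed
  moreover have "w \<in> F ` carrier (H1 piP)" if w: "w \<in> carrier (H1 piP)" for w
  proof -
    obtain a where a: "a \<in> carrier (H1 piF)" "f a = pushforward w"
      using f_iso(2) w by (metis bij_betw_iff_bijections pushforward_closed)
    obtain z where "z \<in> carrier (H1 piP)" "pushforward z = a" "induced_form \<phi> z = induced_form \<phi>' w"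
      using split[OF \<phi> a(1)] by blast
    with a w have "F z = w" by (intro eqI) (simp_all add: F)
    with \<open>z \<in> carrier (H1 piP)\<close> show ?thesis by blast
  qed
  ultimately have "F \<in> iso (H1 piP) (H1 piP)"
    using F(1) by (auto simp: iso_def bij_betw_def)
  moreover have "F (s (\<sigma> i)) = s (f (\<sigma> i))" if "i \<in> {1..2 * g}" for i
    using that q by (intro eqI) (simp_all add: F pushforward_s)
  moreover have "F (\<nu> 0) = \<nu> 0"
    using pushforward_fiber[of 1] by (intro eqI) (simp_all add: F induced_form_\<nu> \<phi> \<phi>' monodromy_fiber)
  ultimately have "is_lift f F" by (simp add: is_lift_def)
  then show "s_related \<phi> \<phi>'"
    unfolding s_related_def using f F(3) by (intro exI[of _ f] exI[of _ F]) simp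
qed

text \<open>A quadratic form is determined by its values on a basis and by its polarization, which here pairs
  only the basis elements \<open>\<sigma> (2 l - 1)\<close> and \<open>\<sigma> (2 l)\<close>.\<close>

lemma quadratic_form_comb:
  assumes \<phi>: "\<phi> \<in> special_monodromies"
  shows "induced_form \<phi> (s (comb d)) =
    (\<Sum>i\<in>{1..2 * g}. d i * (\<phi> (u i) + r i)) + (\<Sum>l\<in>{1..g}. d (2 * l) * d (2 * l - 1))"
proof -
  define q where "q a = induced_form \<phi> (s a)" for a
  have q_mult: "q (a \<otimes>\<^bsub>H1 piF\<^esub> b) = q a + q b + ip a b" if "a \<in> carrier (H1 piF)" "b \<in> carrier (H1 piF)" for a b
    using that by (simp add: q_def s_mult induced_form_mult[OF \<phi>] induced_form_fiber[OF \<phi>])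
  have q_gen: "q (bit_scale (H1 piF) e (\<sigma> i)) = e * (\<phi> (u i) + r i)" if "i \<in> {1..2 * g}" for i e
    using that by (cases e) (simp_all add: q_def s_one s_\<sigma> induced_form_one[OF \<phi>] induced_form_mult[OF \<phi>]
        induced_form_fiber[OF \<phi>] induced_form_\<nu>[OF \<phi>])
  \<comment> \<open>The handles are added one at a time, which keeps the new cross terms inside a single handle.\<close>
  have "h \<le> g \<Longrightarrow> q (comb (\<lambda>i. if i \<le> 2 * h then d i else 0)) =
    (\<Sum>i\<in>{1..2 * h}. d i * (\<phi> (u i) + r i)) + (\<Sum>l\<in>{1..h}. d (2 * l) * d (2 * l - 1))" for h
  proof (induction h)
    case 0
    have "comb (\<lambda>i. if i \<le> 2 * 0 then d i else 0) = \<one>\<^bsub>H1 piF\<^esub>"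
      unfolding comb_zero[symmetric] by (rule comb_cong) auto
    then show ?case by (simp add: q_def s_one induced_form_one[OF \<phi>])
  next
    case (Suc h)
    define a where "a = comb (\<lambda>i. if i \<le> 2 * h then d i else 0)"
    have m: "2 * h + 1 \<in> {1..2 * g}" "2 * h + 2 \<in> {1..2 * g}" using Suc.prems by auto
    define b where "b = bit_scale (H1 piF) (d (2 * h + 1)) (\<sigma> (2 * h + 1))"
    define b' where "b' = bit_scale (H1 piF) (d (2 * h + 2)) (\<sigma> (2 * h + 2))"
    have cl: "a \<in> carrier (H1 piF)" "b \<in> carrier (H1 piF)" "b' \<in> carrier (H1 piF)"
      using m by (simp_all add: a_def b_def b'_def)
    have "comb (\<lambda>i. if i \<le> 2 * Suc h then d i else 0) = a \<otimes>\<^bsub>H1 piF\<^esub> b \<otimes>\<^bsub>H1 piF\<^esub> b'"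
      unfolding a_def b_def b'_def comb_single[OF m(1), symmetric] comb_single[OF m(2), symmetric]
        comb_add[symmetric] by (rule comb_cong) auto
    moreover have "mate (2 * h + 1) = 2 * h + 2" "mate (2 * h + 2) = 2 * h + 1"
      by (simp_all add: mate_def)
    then have "ip a b = 0" "ip a b' = 0" "ip b b' = d (2 * h + 2) * d (2 * h + 1)"
      unfolding a_def b_def b'_def using m
      by (simp_all add: ip_bit_scale ip_comb_\<sigma> ip_\<sigma>)
    ultimately show ?case
      using Suc cl m by (simp add: q_mult ip_left q_gen b_def[symmetric] b'_def[symmetric] flip: a_def)
        (simp add: b_def b'_def q_gen)
  qed
  from this[of g] comb_cong[of d "\<lambda>i. if i \<le> 2 * g then d i else 0"] show ?thesis
    by (simp add: q_def)
qed

text \<open>The vector \<open>W A\<close> collects exactly the terms by which \<open>s (f (\<sigma> j))\<close> differs from the linear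
  combination of the \<open>\<nu> i\<close> given by the \<open>j\<close>-th column of \<open>A\<close>, up to the summand \<open>r j\<close>, which
  appears on both sides.\<close>

lemma quadratic_form_transform_iff:
  assumes \<phi>: "\<phi> \<in> special_monodromies" and \<phi>': "\<phi>' \<in> special_monodromies"
    and A: "has_matrix f A" and j: "j \<in> {1..2 * g}"
  shows "induced_form \<phi> (s (\<sigma> j)) = induced_form \<phi>' (s (f (\<sigma> j))) \<longleftrightarrow>
    \<phi> (u j) = (\<Sum>i\<in>{1..2 * g}. A i j * \<phi>' (u i)) + W A j"
proof -
  have "induced_form \<phi> (s (\<sigma> j)) = \<phi> (u j) + r j"
    using j by (simp add: s_\<sigma> induced_form_mult[OF \<phi>] induced_form_fiber[OF \<phi>] induced_form_\<nu>[OF \<phi>])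
  moreover have "induced_form \<phi>' (s (f (\<sigma> j))) = (\<Sum>i\<in>{1..2 * g}. A i j * \<phi>' (u i)) + W A j + r j"
    using A j by (simp add: has_matrix_def quadratic_form_comb[OF \<phi>'] W_def distrib_left sum.distrib
        add_self ac_simps)
  ultimately show ?thesis by simp
qed

end


section \<open>The relative homology module\<close>

lemma gring_vec_add_self: "(m :: nat \<Rightarrow> gring) + m = 0"
  by (simp add: fun_eq_iff)

lemma gring_vec_add_cancel: "(m :: nat \<Rightarrow> gring) + (m + k) = k"
  by (simp add: fun_eq_iff)

lemma image_set_plus:
  assumes "\<And>a b. h (a + b) = h a + h b"
  shows "h ` (X + Y) = h ` X + h ` Y"
proof (intro equalityI subsetI)
  fix z assume "z \<in> h ` X + h ` Y"
  then obtain a b where "a \<in> X" "b \<in> Y" "z = h (a + b)"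
    by (auto simp: set_plus_def assms)
  then show "z \<in> h ` (X + Y)" by blast
qed (auto simp: assms elim!: set_plus_elim intro!: set_plus_intro)

lemma image_elt_set_plus:
  assumes "\<And>a b. h (a + b) = h a + h b"
  shows "h ` (m +o Y) = h m +o h ` Y"
  using image_set_plus[of h "{m}" Y, OF assms] by (simp add: elt_set_plus_def set_plus_def)

context quadratic_section
begin

lemma scale_apply [simp]: "scale a m i = a * m i"
  by (simp add: scale_def)

lemma scale_add: "scale a (m + k) = scale a m + scale a k"
  by (simp add: fun_eq_iff distrib_left)

lemma v_comb_add: "v_comb \<phi> d y + v_comb \<phi> d' y' = v_comb \<phi> (\<lambda>i. d i + d' i) (y + y')"
  by (auto simp: fun_eq_iff v_comb_apply distrib_right sum.distrib add.assoc add.left_commute)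

lemma v_comb_zero: "v_comb \<phi> (\<lambda>i. 0) 0 = 0"
  by (simp add: fun_eq_iff v_comb_apply)

lemma unit_vec_0_eq: "unit_vec 0 = v_comb \<phi> (\<lambda>i. 0) 1"
  by (auto simp: fun_eq_iff v_comb_apply unit_vec_def)

lemma v_vec_eq: "j \<in> {1..2 * g} \<Longrightarrow> v_vec \<phi> j = v_comb \<phi> (\<lambda>i. if i = j then 1 else 0) 0"
proof -
  assume j: "j \<in> {1..2 * g}"
  then have "(\<Sum>i\<in>{1..2 * g}. scalar ((if i = j then 1 else 0) * \<phi> (u i)))
      = (\<Sum>i\<in>{1..2 * g}. if i = j then scalar (\<phi> (u j)) else 0)"
    by (intro sum.cong) auto
  then show ?thesis
    using j by (auto simp: fun_eq_iff v_comb_apply v_vec_def unit_vec_def sum.delta simp del: scalar_simps(4))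
qed

text \<open>The vectors \<open>v\<^sub>1, \<dots>, v\<^bsub>2g\<^esub>, u\<^sub>0\<close> form a basis of the free module. Splitting the coefficient of each
  \<open>v\<^sub>i\<close> by \<open>gring_decomp\<close> isolates a part in the image of the boundary map; what is left has
  coefficients in the field, except at \<open>u\<^sub>0\<close>.\<close>

lemma free_module_decomp:
  assumes "m \<in> free_module"
  shows "\<exists>d y d'. m = v_comb \<phi> d y + scale norm_elt (v_comb \<phi> d' 0)"
proof -
  define d where "d i = aug (m i)" for i
  define d' where "d' i = Poly_Mapping.lookup (m i) 1" for i
  define y where "y = m 0 + (\<Sum>i\<in>{1..2 * g}. scalar (d i * \<phi> (u i)))
    + norm_elt * (\<Sum>i\<in>{1..2 * g}. scalar (d' i * \<phi> (u i)))"
  have "m i = scalar (d i) + norm_elt * scalar (d' i)" for i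
    unfolding d_def d'_def using gring_decomp[of "m i"] by (simp add: mult.commute)
  then have "m = v_comb \<phi> d y + scale norm_elt (v_comb \<phi> d' 0)"
    using assms by (auto simp: fun_eq_iff v_comb_apply y_def free_module_def ac_simps simp del: scalar_simps)
  then show ?thesis by blast
qed

lemma im_diff_add:
  assumes \<phi>: "\<phi> \<in> special_monodromies" and "k \<in> im_diff \<phi>" "l \<in> im_diff \<phi>"
  shows "k + l \<in> im_diff \<phi>"
proof -
  obtain d e d' e' where "k = scale norm_elt (v_comb \<phi> d (scalar (e * chern_bit)))"
    "l = scale norm_elt (v_comb \<phi> d' (scalar (e' * chern_bit)))"
    using assms unfolding im_diff_eq[OF \<phi>] by blast
  then have "k + l = scale norm_elt (v_comb \<phi> (\<lambda>i. d i + d' i) (scalar ((e + e') * chern_bit)))"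
    by (simp add: v_comb_add distrib_right flip: scale_add)
  then show ?thesis unfolding im_diff_eq[OF \<phi>] by blast
qed

lemma scale_norm_elt_v_comb_in_im_diff:
  assumes \<phi>: "\<phi> \<in> special_monodromies"
  shows "scale norm_elt (v_comb \<phi> d 0) \<in> im_diff \<phi>"
  unfolding im_diff_eq[OF \<phi>] by (intro CollectI exI[of _ d] exI[of _ 0]) simp

lemma zero_in_im_diff: "\<phi> \<in> special_monodromies \<Longrightarrow> 0 \<in> im_diff \<phi>"
  using scale_norm_elt_v_comb_in_im_diff[of \<phi> "\<lambda>i. 0"] by (simp add: v_comb_zero scale_def zero_fun_def)

lemma aug_im_diff: "\<phi> \<in> special_monodromies \<Longrightarrow> k \<in> im_diff \<phi> \<Longrightarrow> aug (k i) = 0"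
  by (auto simp: im_diff_eq)

lemma im_diff_subset: "\<phi> \<in> special_monodromies \<Longrightarrow> im_diff \<phi> \<subseteq> free_module"
  by (auto simp: im_diff_eq free_module_def v_comb_apply)

lemma cls_eq_iff:
  assumes \<phi>: "\<phi> \<in> special_monodromies"
  shows "cls \<phi> m = cls \<phi> k \<longleftrightarrow> m + k \<in> im_diff \<phi>"
proof
  assume "cls \<phi> m = cls \<phi> k"
  moreover have "m \<in> cls \<phi> m"
    using zero_in_im_diff[OF \<phi>] unfolding cls_def elt_set_plus_def by force
  ultimately obtain l where "l \<in> im_diff \<phi>" "m = k + l"
    by (auto simp: cls_def elt_set_plus_def)
  then show "m + k \<in> im_diff \<phi>"
    by (simp add: add.commute[of _ k] gring_vec_add_cancel)
next
  assume *: "m + k \<in> im_diff \<phi>"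
  have "cls \<phi> m \<subseteq> cls \<phi> k" if "m + k \<in> im_diff \<phi>" for m k
  proof
    fix z assume "z \<in> cls \<phi> m"
    then obtain l where l: "l \<in> im_diff \<phi>" "z = m + l"
      by (auto simp: cls_def elt_set_plus_def)
    then have "z = k + ((m + k) + l)"
      by (simp add: gring_vec_add_cancel ac_simps)
    then show "z \<in> cls \<phi> k"
      using im_diff_add[OF \<phi> that l(1)] unfolding cls_def elt_set_plus_def by blast
  qed
  from this[OF *] this[of k m] * show "cls \<phi> m = cls \<phi> k"
    by (simp add: add.commute)
qed

lemma rel_homology_normal_form:
  assumes \<phi>: "\<phi> \<in> special_monodromies" and "X \<in> rel_homology \<phi>"
  shows "\<exists>d y. X = cls \<phi> (v_comb \<phi> d y)"
proof -
  obtain m where m: "m \<in> free_module" "X = cls \<phi> m"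
    using assms by (auto simp: rel_homology_def)
  obtain d y d' where "m = v_comb \<phi> d y + scale norm_elt (v_comb \<phi> d' 0)"
    using free_module_decomp[OF m(1)] by blast
  then have "X = cls \<phi> (v_comb \<phi> d y)"
    unfolding m(2) cls_eq_iff[OF \<phi>]
    using scale_norm_elt_v_comb_in_im_diff[OF \<phi>, of d'] by (simp add: add.commute[of _ "v_comb \<phi> d y"] gring_vec_add_cancel)
  then show ?thesis by blast
qed

text \<open>The coefficients of the \<open>v\<^sub>i\<close> are well defined on classes, because elements of the image of the
  boundary map have augmentation zero in every coordinate.\<close>

lemma proj_cls:
  assumes \<phi>: "\<phi> \<in> special_monodromies"
  shows "proj \<phi> (cls \<phi> (v_comb \<phi> d y)) = comb d"
  unfolding proj_def
proof (rule the_equality)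
  fix z assume "\<exists>d' y'. cls \<phi> (v_comb \<phi> d y) = cls \<phi> (v_comb \<phi> d' y') \<and> z = comb d'"
  then obtain d' y' where *: "cls \<phi> (v_comb \<phi> d y) = cls \<phi> (v_comb \<phi> d' y')" "z = comb d'"
    by blast
  have "d i = d' i" if "i \<in> {1..2 * g}" for i
  proof -
    have "aug ((v_comb \<phi> d y + v_comb \<phi> d' y') i) = 0"
      using *(1) unfolding cls_eq_iff[OF \<phi>] by (rule aug_im_diff[OF \<phi>])
    then have "d i + d' i = 0" using that by (simp add: v_comb_apply)
    then show ?thesis by (cases "d i"; cases "d' i") auto
  qed
  then show "z = comb d" unfolding *(2) by (intro comb_cong) auto
qed blast

section \<open>Quotient isomorphisms\<close>

abbreviation mat_vec :: "(nat \<Rightarrow> nat \<Rightarrow> bit) \<Rightarrow> (nat \<Rightarrow> bit) \<Rightarrow> nat \<Rightarrow> bit" where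
  "mat_vec A d \<equiv> \<lambda>i. \<Sum>j\<in>{1..2 * g}. A i j * d j"

lemma psi_add: "psi A (m + k) = psi A m + psi A k"
  by (simp add: psi_def fun_eq_iff distrib_left sum.distrib)

lemma psi_scale: "psi A (scale a m) = scale a (psi A m)"
  by (auto simp: psi_def fun_eq_iff sum_distrib_left mult.left_commute intro!: sum.cong)

lemma psi_closed: "psi A m \<in> free_module"
  by (simp add: psi_def free_module_def)

lemma psi_apply:
  "psi A m i = (if i = 0 then m 0 + (\<Sum>j\<in>{1..2 * g}. scalar (W A j) * m j)
    else if i \<le> 2 * g then \<Sum>j\<in>{1..2 * g}. scalar (A i j) * m j else 0)"
proof -
  have ins: "{0..2 * g} = insert 0 {1..2 * g}" by auto
  have "(\<Sum>j\<in>{1..2 * g}. scalar (J A i j) * m j) =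
     (\<Sum>j\<in>{1..2 * g}. scalar (if i = 0 then W A j else A i j) * m j)"
    by (intro sum.cong) (auto simp: J_def)
  then show ?thesis unfolding psi_def ins by (simp add: J_def)
qed

lemma psi_v_comb_apply_0:
  "psi A (v_comb \<phi> d y) 0 = (\<Sum>j\<in>{1..2 * g}. scalar (d j * (\<phi> (u j) + W A j))) + y"
proof -
  have "(\<Sum>j\<in>{1..2 * g}. scalar (W A j) * v_comb \<phi> d y j) = (\<Sum>j\<in>{1..2 * g}. scalar (W A j) * scalar (d j))"
    by (intro sum.cong) (auto simp: v_comb_apply)
  then show ?thesis
    by (simp add: psi_apply v_comb_apply distrib_left sum.distrib ac_simps)
qed

text \<open>The two representatives differ by a scalar multiple of \<open>u\<^sub>0\<close>, and the augmentation of their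
  difference at \<open>u\<^sub>0\<close> must vanish.\<close>

lemma monodromy_matrix_if_block:
  assumes \<phi>: "\<phi> \<in> special_monodromies" and \<phi>': "\<phi>' \<in> special_monodromies"
    and j: "j \<in> {1..2 * g}"
    and cls: "cls \<phi>' (psi A (v_vec \<phi> j)) = cls \<phi>' (v_comb \<phi>' (\<lambda>i. A i j) 0)"
  shows "\<phi> (u j) = (\<Sum>i\<in>{1..2 * g}. A i j * \<phi>' (u i)) + W A j"
proof -
  have "(\<Sum>k\<in>{1..2 * g}. scalar ((if k = j then 1 else 0) * (\<phi> (u k) + W A k)))
     = (\<Sum>k\<in>{1..2 * g}. if k = j then scalar (\<phi> (u j) + W A j) else 0)"
    by (intro sum.cong) auto
  then have "psi A (v_vec \<phi> j) 0 = scalar (\<phi> (u j) + W A j)"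
    using j by (simp add: v_vec_eq[OF j] psi_v_comb_apply_0 sum.delta del: scalar_simps)
  moreover have "aug ((psi A (v_vec \<phi> j) + v_comb \<phi>' (\<lambda>i. A i j) 0) 0) = 0"
    using cls unfolding cls_eq_iff[OF \<phi>'] by (rule aug_im_diff[OF \<phi>'])
  ultimately have "\<phi> (u j) + W A j + (\<Sum>i\<in>{1..2 * g}. A i j * \<phi>' (u i)) = 0"
    by (simp add: v_comb_apply aug_sum del: scalar_simps)
  then show ?thesis
    by (cases "\<phi> (u j)"; cases "W A j"; cases "\<Sum>i\<in>{1..2 * g}. A i j * \<phi>' (u i)") auto
qed

text \<open>Under the equation for the monodromies \<open>psi A\<close> has block form \<open>diag(A, 1)\<close> in the bases of the
  \<open>v\<^sub>i\<close> and \<open>u\<^sub>0\<close>: the last row of \<open>J A\<close> is exactly compensated by passing from the \<open>u\<^sub>i\<close> to the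
  \<open>v\<^sub>i\<close> for the two monodromies.\<close>

lemma psi_v_comb:
  assumes rel: "\<And>j. j \<in> {1..2 * g} \<Longrightarrow> \<phi> (u j) = (\<Sum>i\<in>{1..2 * g}. A i j * \<phi>' (u i)) + W A j"
  shows "psi A (v_comb \<phi> d y) = v_comb \<phi>' (mat_vec A d) y"
proof
  fix i
  show "psi A (v_comb \<phi> d y) i = v_comb \<phi>' (mat_vec A d) y i"
  proof (cases "i = 0")
    case True
    have "(\<Sum>j\<in>{1..2 * g}. d j * (\<phi> (u j) + W A j))
        = (\<Sum>j\<in>{1..2 * g}. \<Sum>i\<in>{1..2 * g}. d j * (A i j * \<phi>' (u i)))"
      by (intro sum.cong) (auto simp: rel add.assoc sum_distrib_left)
    also have "\<dots> = (\<Sum>i\<in>{1..2 * g}. mat_vec A d i * \<phi>' (u i))"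
      by (subst sum.swap) (simp add: sum_distrib_right mult.assoc mult.left_commute)
    finally show ?thesis
      using True by (simp add: psi_v_comb_apply_0 v_comb_apply del: scalar_simps flip: scalar_sum)
  next
    case False
    have "(\<Sum>j\<in>{1..2 * g}. scalar (A i j) * v_comb \<phi> d y j) = (\<Sum>j\<in>{1..2 * g}. scalar (A i j * d j))"
      by (intro sum.cong) (auto simp: v_comb_apply)
    then show ?thesis
      using False by (simp add: psi_apply v_comb_apply scalar_sum)
  qed
qed

text \<open>Since \<open>f\<close> is bijective, so is \<open>A\<close> on coordinate vectors. By \<open>psi_v_comb\<close> the map \<open>psi A\<close> is then a
  bijection of the free module that carries one image of the boundary map onto the other. Hence
  taking images of cosets under \<open>psi A\<close> is the induced map of the quotients, and additivity and
  linearity are inherited from \<open>psi A\<close>.\<close>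

lemma quotient_exists:
  assumes \<phi>: "\<phi> \<in> special_monodromies" and \<phi>': "\<phi>' \<in> special_monodromies"
    and f: "symplectic f" and A: "has_matrix f A"
    and rel: "\<And>j. j \<in> {1..2 * g} \<Longrightarrow> \<phi> (u j) = (\<Sum>i\<in>{1..2 * g}. A i j * \<phi>' (u i)) + W A j"
  shows "is_quotient \<phi> \<phi>' ((`) (psi A))"
proof -
  from f have f_hom: "f \<in> hom (H1 piF) (H1 piF)"
    and f_bij: "bij_betw f (carrier (H1 piF)) (carrier (H1 piF))"
    by (auto simp: symplectic_def iso_def)
  note f_comb = matrix_apply[OF f_hom A]
  have psi_v: "psi A (v_comb \<phi> d y) = v_comb \<phi>' (mat_vec A d) y" for d y
    using rel by (rule psi_v_comb)
  have surj: "\<exists>e. \<forall>i\<in>{1..2 * g}. mat_vec A e i = d i" for d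
  proof -
    obtain a where "a \<in> carrier (H1 piF)" "f a = comb d"
      using f_bij by (metis bij_betw_iff_bijections comb_closed)
    then obtain e where "comb (mat_vec A e) = comb d"
      using comb_exists f_comb by metis
    then show ?thesis using comb_inject by blast
  qed
  have inj: "d i = 0" if "\<And>i. i \<in> {1..2 * g} \<Longrightarrow> mat_vec A d i = 0" "i \<in> {1..2 * g}" for d i
  proof -
    have "f (comb d) = f (comb (\<lambda>i. 0))"
      unfolding f_comb using that(1) by (intro comb_cong) simp
    then have "comb d = comb (\<lambda>i. 0)"
      using f_bij by (meson bij_betw_imp_inj_on comb_closed inj_onD)
    then show ?thesis using comb_inject that(2) by blast
  qed
  have psi_im: "psi A ` im_diff \<phi> = im_diff \<phi>'"
  proof (intro equalityI subsetI)
    fix k assume "k \<in> psi A ` im_diff \<phi>"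
    then obtain d e where "k = psi A (scale norm_elt (v_comb \<phi> d (scalar (e * chern_bit))))"
      unfolding im_diff_eq[OF \<phi>] by blast
    then have "k = scale norm_elt (v_comb \<phi>' (mat_vec A d) (scalar (e * chern_bit)))"
      by (simp only: psi_scale psi_v)
    then show "k \<in> im_diff \<phi>'"
      unfolding im_diff_eq[OF \<phi>'] by blast
  next
    fix k assume "k \<in> im_diff \<phi>'"
    then obtain d e where k: "k = scale norm_elt (v_comb \<phi>' d (scalar (e * chern_bit)))"
      by (auto simp: im_diff_eq \<phi>')
    obtain d' where "\<forall>i\<in>{1..2 * g}. mat_vec A d' i = d i" using surj[of d] by blast
    then have "k = psi A (scale norm_elt (v_comb \<phi> d' (scalar (e * chern_bit))))"
      unfolding k psi_scale psi_v by (intro arg_cong[of _ _ "scale norm_elt"] v_comb_cong) simp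
    then show "k \<in> psi A ` im_diff \<phi>"
      unfolding im_diff_eq[OF \<phi>] by blast
  qed
  have psi_cls: "psi A ` cls \<phi> m = cls \<phi>' (psi A m)" for m
    by (simp add: cls_def image_elt_set_plus[of "psi A", OF psi_add] psi_im)
  have psi_surj: "\<exists>k\<in>free_module. psi A k = m" if m: "m \<in> free_module" for m
  proof -
    obtain d y d' where m: "m = v_comb \<phi>' d y + scale norm_elt (v_comb \<phi>' d' 0)"
      using free_module_decomp[OF m] by blast
    obtain e e' where "\<forall>i\<in>{1..2 * g}. mat_vec A e i = d i" "\<forall>i\<in>{1..2 * g}. mat_vec A e' i = d' i"
      using surj[of d] surj[of d'] by blast
    then have "v_comb \<phi>' (mat_vec A e) y = v_comb \<phi>' d y" "v_comb \<phi>' (mat_vec A e') 0 = v_comb \<phi>' d' 0"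
      by (auto intro!: v_comb_cong)
    then have "psi A (v_comb \<phi> e y + scale norm_elt (v_comb \<phi> e' 0)) = m"
      by (simp add: psi_add psi_scale psi_v m)
    moreover have "v_comb \<phi> e y + scale norm_elt (v_comb \<phi> e' 0) \<in> free_module"
      by (simp add: free_module_def v_comb_apply)
    ultimately show ?thesis by blast
  qed
  have psi_kernel: "m = 0" if m_free: "m \<in> free_module" and psi_0: "psi A m = 0" for m
  proof -
    obtain d y d' where m: "m = v_comb \<phi> d y + scale norm_elt (v_comb \<phi> d' 0)"
      using free_module_decomp[OF m_free] by blast
    then have *: "v_comb \<phi>' (mat_vec A d) y + scale norm_elt (v_comb \<phi>' (mat_vec A d') 0) = 0"
      using psi_0 by (simp add: psi_add psi_scale psi_v)
    have "mat_vec A d i = 0 \<and> mat_vec A d' i = 0" if "i \<in> {1..2 * g}" for i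
      using fun_cong[OF *, of i] that by (intro gring_normal_form_eq_0) (simp add: v_comb_apply)
    then have "d i = 0" "d' i = 0" if "i \<in> {1..2 * g}" for i
      using inj that by blast+
    then have "v_comb \<phi> d y = v_comb \<phi> (\<lambda>i. 0) y" "v_comb \<phi> d' 0 = v_comb \<phi> (\<lambda>i. 0) 0"
      by (auto intro!: v_comb_cong)
    then have m': "m = v_comb \<phi> (\<lambda>i. 0) y"
      by (simp add: m v_comb_zero) (simp add: fun_eq_iff)
    have "y = 0" using fun_cong[OF psi_0, of 0] by (simp add: m' psi_v v_comb_apply)
    then show ?thesis by (simp add: m' v_comb_zero)
  qed
  have psi_inj: "inj_on (psi A) free_module"
  proof (rule inj_onI)
    fix m k assume m: "m \<in> free_module" and k: "k \<in> free_module" and eq: "psi A m = psi A k"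
    have "m + k \<in> free_module"
      using m k unfolding free_module_def by auto
    moreover have "psi A (m + k) = 0"
      by (simp only: psi_add eq gring_vec_add_self)
    ultimately have sum: "m + k = 0" by (rule psi_kernel)
    have "k = m + (m + k)" by (simp only: gring_vec_add_cancel)
    also have "\<dots> = m" by (simp only: sum add_0_right)
    finally show "m = k" ..
  qed
  have cls_subset: "X \<subseteq> free_module" if "X \<in> rel_homology \<phi>" for X
    using that im_diff_subset[OF \<phi>]
    by (fastforce simp: rel_homology_def cls_def elt_set_plus_def free_module_def)
  have "inj_on ((`) (psi A)) (rel_homology \<phi>)"
    using inj_on_image_eq_iff[OF psi_inj] cls_subset by (auto intro: inj_onI)
  moreover have "(`) (psi A) ` rel_homology \<phi> = rel_homology \<phi>'"
  proof (intro equalityI subsetI)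
    fix Y assume "Y \<in> (`) (psi A) ` rel_homology \<phi>"
    then show "Y \<in> rel_homology \<phi>'"
      by (auto simp: rel_homology_def psi_cls psi_closed)
  next
    fix Y assume "Y \<in> rel_homology \<phi>'"
    then obtain k where "k \<in> free_module" "Y = cls \<phi>' (psi A k)"
      using psi_surj by (auto simp: rel_homology_def)
    then show "Y \<in> (`) (psi A) ` rel_homology \<phi>"
      by (auto simp: rel_homology_def simp flip: psi_cls)
  qed
  ultimately have "bij_betw ((`) (psi A)) (rel_homology \<phi>) (rel_homology \<phi>')"
    by (simp add: bij_betw_def)
  moreover have "psi A ` cls_scale \<phi> a X = cls_scale \<phi>' a (psi A ` X)" for a X
    by (simp add: cls_scale_def image_set_plus[of "psi A", OF psi_add] psi_im image_image psi_scale)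
  ultimately have iso: "module_iso \<phi> \<phi>' ((`) (psi A))"
    by (simp add: module_iso_def image_set_plus[of "psi A", OF psi_add])
  have proj: "proj \<phi>' (psi A ` X) = f (proj \<phi> X) \<and> proj \<phi> X \<in> carrier (H1 piF)"
    if X: "X \<in> rel_homology \<phi>" for X
  proof -
    obtain d y where "X = cls \<phi> (v_comb \<phi> d y)"
      using rel_homology_normal_form[OF \<phi> X] by blast
    then show ?thesis by (simp add: psi_cls psi_v proj_cls \<phi> \<phi>' f_comb)
  qed
  then have "respects_star \<phi> \<phi>' ((`) (psi A))"
    using f by (simp add: respects_star_def star_def symplectic_def)
  moreover have "has_block_matrix \<phi> \<phi>' A ((`) (psi A))"
  proof -
    have "mat_vec A (\<lambda>i. if i = j then 1 else 0) i = A i j" if "j \<in> {1..2 * g}" for i j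
    proof -
      have "mat_vec A (\<lambda>i. if i = j then 1 else 0) i = (\<Sum>k\<in>{1..2 * g}. if k = j then A i j else 0)"
        by (intro sum.cong) auto
      then show ?thesis using that by (simp add: sum.delta)
    qed
    then have "psi A ` cls \<phi> (v_vec \<phi> j) = cls \<phi>' (v_comb \<phi>' (\<lambda>i. A i j) 0)" if "j \<in> {1..2 * g}" for j
      using that by (simp add: v_vec_eq psi_cls psi_v)
    moreover have "psi A ` cls \<phi> (unit_vec 0) = cls \<phi>' (unit_vec 0)"
      using psi_v[of "\<lambda>i. 0" 1] by (simp add: psi_cls flip: unit_vec_0_eq)
    ultimately show ?thesis by (simp add: has_block_matrix_def)
  qed
  ultimately show ?thesis
    unfolding is_quotient_def using iso f A proj psi_im psi_cls
    by (intro conjI exI[of _ f] exI[of _ A]) auto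
qed

lemma v_vec_closed: "j \<in> {1..2 * g} \<Longrightarrow> v_vec \<phi> j \<in> free_module"
  using v_vec_eq v_comb_closed by simp

text \<open>Both conditions amount to a symplectic \<open>f\<close> with matrix \<open>A\<close> such that
  \<open>n\<^sub>j = (\<Sum>i. A i j * n'\<^sub>i) + W A j\<close> for all \<open>j\<close>.\<close>

lemma quotient_iff_s_related:
  assumes \<phi>: "\<phi> \<in> special_monodromies" and \<phi>': "\<phi>' \<in> special_monodromies"
  shows "(\<exists>\<Psi>. is_quotient \<phi> \<phi>' \<Psi>) \<longleftrightarrow> s_related \<phi> \<phi>'"
proof
  assume "\<exists>\<Psi>. is_quotient \<phi> \<phi>' \<Psi>"
  then obtain \<Psi> where "is_quotient \<phi> \<phi>' \<Psi>" ..
  then obtain f A where f: "symplectic f" "has_matrix f A"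
    and block: "has_block_matrix \<phi> \<phi>' A \<Psi>"
    and psi: "\<forall>m\<in>free_module. \<Psi> (cls \<phi> m) = cls \<phi>' (psi A m)"
    unfolding is_quotient_def by (elim conjE exE) (rule that)
  have "\<phi> (u j) = (\<Sum>i\<in>{1..2 * g}. A i j * \<phi>' (u i)) + W A j" if "j \<in> {1..2 * g}" for j
  proof (rule monodromy_matrix_if_block[OF \<phi> \<phi>' that])
    have "\<Psi> (cls \<phi> (v_vec \<phi> j)) = cls \<phi>' (psi A (v_vec \<phi> j))"
      using psi v_vec_closed[OF that] by blast
    moreover have "\<Psi> (cls \<phi> (v_vec \<phi> j)) = cls \<phi>' (v_comb \<phi>' (\<lambda>i. A i j) 0)"
      using block that by (simp only: has_block_matrix_def)
    ultimately show "cls \<phi>' (psi A (v_vec \<phi> j)) = cls \<phi>' (v_comb \<phi>' (\<lambda>i. A i j) 0)"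
      by simp
  qed
  then show "s_related \<phi> \<phi>'"
    unfolding s_related_iff[OF \<phi> \<phi>']
    using f quadratic_form_transform_iff[OF \<phi> \<phi>' f(2)] by blast
next
  assume "s_related \<phi> \<phi>'"
  then obtain f where f: "symplectic f"
    and q: "\<And>j. j \<in> {1..2 * g} \<Longrightarrow> induced_form \<phi> (s (\<sigma> j)) = induced_form \<phi>' (s (f (\<sigma> j)))"
    unfolding s_related_iff[OF \<phi> \<phi>'] by blast
  have "\<exists>d. f (\<sigma> j) = comb d" if "j \<in> {1..2 * g}" for j
    using f that by (intro comb_exists) (auto simp: symplectic_def iso_def hom_def)
  then obtain B where B: "\<And>j. j \<in> {1..2 * g} \<Longrightarrow> f (\<sigma> j) = comb (B j)"
    by metis
  define A where "A i j = B j i" for i j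
  have A: "has_matrix f A" using B by (simp add: has_matrix_def A_def)
  have "is_quotient \<phi> \<phi>' ((`) (psi A))"
    using q quadratic_form_transform_iff[OF \<phi> \<phi>' A] by (intro quotient_exists[OF \<phi> \<phi>' f A]) blast
  then show "\<exists>\<Psi>. is_quotient \<phi> \<phi>' \<Psi>" by blast
qed

end

theorem theorem37:
  fixes g :: nat and c :: int
    and piF :: "('f, 'm) monoid_scheme" and x :: "nat \<Rightarrow> 'f"
    and piP :: "('p, 'n) monoid_scheme" and u :: "nat \<Rightarrow> 'p" and p :: "'p \<Rightarrow> 'f"
    and ip :: "'f set \<Rightarrow> 'f set \<Rightarrow> bit"
    and r :: "nat \<Rightarrow> bit" and s :: "'f set \<Rightarrow> 'p set"
    and \<phi> \<phi>' :: "'p \<Rightarrow> bit"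
  assumes "quadratic_section g c piF x piP u p ip r s"
    and "\<phi> \<in> quadratic_section.special_monodromies piP u"
    and "\<phi>' \<in> quadratic_section.special_monodromies piP u"
  shows "(\<exists>\<Psi>. quadratic_section.module_iso g c piP u \<phi> \<phi>' \<Psi> \<and>
              quadratic_section.is_quotient g c piF x piP u ip r \<phi> \<phi>' \<Psi>)
         \<longleftrightarrow> quadratic_section.s_related g piF x piP u ip s \<phi> \<phi>'"
proof -
  interpret quadratic_section g c piF x piP u p ip r s by fact
  have "(\<exists>\<Psi>. module_iso \<phi> \<phi>' \<Psi> \<and> is_quotient \<phi> \<phi>' \<Psi>) \<longleftrightarrow> (\<exists>\<Psi>. is_quotient \<phi> \<phi>' \<Psi>)"
    by (auto simp: is_quotient_def)
  also have "\<dots> \<longleftrightarrow> s_related \<phi> \<phi>'"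
    using assms(2,3) by (rule quotient_iff_s_related)
  finally show ?thesis .
qed

end
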